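(* Let $G$ be a factor graph with $n$ variables, at most $s$ states per variable, $e$ factors, maximum factor weight $M$, and hierarchy width $h$. Then the mixing time of Gibbs sampling on $G$ satisfies $$t_{\mathrm{mix}} \le \left(\log(4) + n\log(s) + eM\right)\, n \exp(3hM).$$ In particular, over any class of factor graphs for which $e$ is polynomial in $n$, the number of values for each variable is bounded, and $hM = O(\log n)$, one has $t_{\mathrm{mix}} = O(n^{O(1)})$.
   Context: A factor graph $G=\langle V,\Phi\rangle$ consists of a finite set $V$ of discrete variables (each taking finitely many values, called states) and a finite set $\Phi$ of factors. A world $I$ is an assignment of a value to each variable; each factor $\phi\in\Phi$ is a real-valued function of the world that depends only on some subset of the variables. The energy of a world is $\epsilon(I)=\sum_{\phi\in\Phi}\phi(I)$, and $G$ determines the distribution $\pi(I)=\frac1Z\exp(\epsilon(I))$ on the set $\Omega$ of worlds, with $Z$ the normalization constant. $G$ is viewed as a bipartite graph in which a variable $v$ is joined to a factor $\phi$ iff $\phi$ depends on $v$; connectedness and connected components refer to this bipartite graph. Gibbs sampling on $G$ is the Markov chain on $\Omega$ which, at each step, picks one of the $n$ variables uniformly at random and resamples its value from its conditional distribution under $\pi$ given the current values of all other variables. Mixing time: $t_{\mathrm{mix}}$ is the first time $t$ such that, for every initial distribution, the law $\mu_t$ of the chain at time $t$ satisfies $\max_{A\subset\Omega}|\mu_t(A)-\pi(A)|\le\frac14$. Hierarchy width $\mathsf{hw}(G)$ is defined recursively: if $G$ has no factors, $\mathsf{hw}(G)=0$; if $G=\langle V,\Phi\rangle$ is connected (with at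 least one factor), $\mathsf{hw}(G)=1+\min_{\phi^*\in\Phi}\mathsf{hw}(\langle V,\Phi-\{\phi^*\}\rangle)$; if $G$ is disconnected with connected components $G_1,G_2,\dots$, $\mathsf{hw}(G)=\max_i\mathsf{hw}(G_i)$. Maximum factor weight: $M=\max_{\phi\in\Phi}\left(\max_I\phi(I)-\min_I\phi(I)\right)$ (taken to be $0$ if there are no factors). Logarithms are natural. *)

theory Defs
  imports "HOL-Probability.Probability" "HOL-Library.Landau_Symbols"
begin

text \<open>
  Factors are indexed by \<open>factors G\<close>, so two distinct factors may have the same function
  \<open>potential G f\<close>. Worlds are extensional functions in \<open>Pi\<^sub>E (vars G) (states G)\<close>; the values of
  \<open>potential G f\<close> outside this set are irrelevant.
\<close>

record ('v, 'a, 'f) factor_graph =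
  vars :: "'v set"
  states :: "'v \<Rightarrow> 'a set"
  factors :: "'f set"
  potential :: "'f \<Rightarrow> ('v \<Rightarrow> 'a) \<Rightarrow> real"

definition is_factor_graph :: "('v, 'a, 'f) factor_graph \<Rightarrow> bool" where
  "is_factor_graph G \<longleftrightarrow>
     finite (vars G) \<and> finite (factors G) \<and>
     (\<forall>v\<in>vars G. finite (states G v) \<and> states G v \<noteq> {})"

definition worlds :: "('v, 'a, 'f) factor_graph \<Rightarrow> ('v \<Rightarrow> 'a) set" where
  "worlds G = Pi\<^sub>E (vars G) (states G)"

definition energy :: "('v, 'a, 'f) factor_graph \<Rightarrow> ('v \<Rightarrow> 'a) \<Rightarrow> real" where
  "energy G I = (\<Sum>f\<in>factors G. potential G f I)"

definition partition_constant :: "('v, 'a, 'f) factor_graph \<Rightarrow> real" where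
  "partition_constant G = (\<Sum>I\<in>worlds G. exp (energy G I))"

definition gibbs_distribution :: "('v, 'a, 'f) factor_graph \<Rightarrow> ('v \<Rightarrow> 'a) pmf" where
  "gibbs_distribution G =
     embed_pmf (\<lambda>I. if I \<in> worlds G then exp (energy G I) / partition_constant G else 0)"

text \<open>
  Resampling \<open>v\<close> given the other variables is drawing a world from \<open>gibbs_distribution G\<close>
  conditioned on agreeing with the current world off \<open>v\<close>.
\<close>

definition gibbs_step :: "('v, 'a, 'f) factor_graph \<Rightarrow> ('v \<Rightarrow> 'a) \<Rightarrow> ('v \<Rightarrow> 'a) pmf" where
  "gibbs_step G I =
     bind_pmf (pmf_of_set (vars G))
       (\<lambda>v. cond_pmf (gibbs_distribution G) {J. \<forall>w\<in>vars G - {v}. J w = I w})"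

definition gibbs_law ::
  "('v, 'a, 'f) factor_graph \<Rightarrow> ('v \<Rightarrow> 'a) pmf \<Rightarrow> nat \<Rightarrow> ('v \<Rightarrow> 'a) pmf" where
  "gibbs_law G \<mu> t = ((\<lambda>\<nu>. bind_pmf \<nu> (gibbs_step G)) ^^ t) \<mu>"

definition tv_distance :: "'w set \<Rightarrow> 'w pmf \<Rightarrow> 'w pmf \<Rightarrow> real" where
  "tv_distance \<Omega> p q = (MAX A\<in>Pow \<Omega>. \<bar>measure_pmf.prob p A - measure_pmf.prob q A\<bar>)"

definition mixed_at :: "('v, 'a, 'f) factor_graph \<Rightarrow> nat \<Rightarrow> bool" where
  "mixed_at G t \<longleftrightarrow>
     (\<forall>\<mu>. set_pmf \<mu> \<subseteq> worlds G \<longrightarrow>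
        tv_distance (worlds G) (gibbs_law G \<mu> t) (gibbs_distribution G) \<le> 1 / 4)"

text \<open>
  The value is meaningful only if \<open>mixed_at G t\<close> holds for some \<open>t\<close>.
\<close>

definition mixing_time :: "('v, 'a, 'f) factor_graph \<Rightarrow> nat" where
  "mixing_time G = (LEAST t. mixed_at G t)"

definition max_factor_weight :: "('v, 'a, 'f) factor_graph \<Rightarrow> real" where
  "max_factor_weight G =
     (if factors G = {} then 0
      else MAX f\<in>factors G.
        (MAX I\<in>worlds G. potential G f I) - (MIN I\<in>worlds G. potential G f I))"

definition depends_on :: "('v, 'a, 'f) factor_graph \<Rightarrow> 'f \<Rightarrow> 'v \<Rightarrow> bool" where
  "depends_on G f v \<longleftrightarrow>
     (\<exists>I\<in>worlds G. \<exists>J\<in>worlds G.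
        (\<forall>w\<in>vars G - {v}. I w = J w) \<and> potential G f I \<noteq> potential G f J)"

definition graph_edges :: "('f \<Rightarrow> 'v \<Rightarrow> bool) \<Rightarrow> 'v set \<Rightarrow> 'f set \<Rightarrow> ('v + 'f) rel" where
  "graph_edges dep V F =
     {(Inl v, Inr f) | v f. v \<in> V \<and> f \<in> F \<and> dep f v} \<union>
     {(Inr f, Inl v) | v f. v \<in> V \<and> f \<in> F \<and> dep f v}"

definition graph_connected :: "('f \<Rightarrow> 'v \<Rightarrow> bool) \<Rightarrow> 'v set \<Rightarrow> 'f set \<Rightarrow> bool" where
  "graph_connected dep V F \<longleftrightarrow>
     (\<forall>x\<in>V <+> F. \<forall>y\<in>V <+> F. (x, y) \<in> (graph_edges dep V F)\<^sup>*)"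

definition graph_components ::
  "('f \<Rightarrow> 'v \<Rightarrow> bool) \<Rightarrow> 'v set \<Rightarrow> 'f set \<Rightarrow> ('v + 'f) set set" where
  "graph_components dep V F = (V <+> F) // (graph_edges dep V F)\<^sup>*"

lemma graph_component_subset:
  assumes "C \<in> graph_components dep V F"
  shows "C \<subseteq> V <+> F"
proof
  fix y assume "y \<in> C"
  with assms obtain x where x: "x \<in> V <+> F" "(x, y) \<in> (graph_edges dep V F)\<^sup>*"
    by (auto simp: graph_components_def quotient_def)
  from x(2,1) show "y \<in> V <+> F"
    by (induction rule: rtrancl_induct) (auto simp: graph_edges_def)
qed

lemma graph_component_psubset:
  assumes "C \<in> graph_components dep V F" and "\<not> graph_connected dep V F"
  shows "C \<subset> V <+> F"
proof -
  have sym: "sym ((graph_edges dep V F)\<^sup>*)"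
    by (rule sym_rtrancl) (auto simp: sym_def graph_edges_def)
  from assms(1) obtain x where C: "C = (graph_edges dep V F)\<^sup>* `` {x}"
    by (auto simp: graph_components_def quotient_def)
  have "C \<noteq> V <+> F"
  proof
    assume "C = V <+> F"
    then have *: "(x, y) \<in> (graph_edges dep V F)\<^sup>*" if "y \<in> V <+> F" for y
      using that C by auto
    have "graph_connected dep V F"
      unfolding graph_connected_def
      by (meson * sym symD rtrancl_trans)
    with assms(2) show False ..
  qed
  with graph_component_subset[OF assms(1)] show ?thesis by blast
qed

text \<open>
  Hierarchy width of the subgraph with variables \<open>V\<close> and factors \<open>F\<close>. It depends only on the
  bipartite graph, and deleting factors or passing to a component does not change which
  variables a remaining factor depends on; so \<open>dep\<close> is a fixed parameter.
\<close>

function hwidth :: "('f \<Rightarrow> 'v \<Rightarrow> bool) \<Rightarrow> 'v set \<Rightarrow> 'f set \<Rightarrow> nat" where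
  "hwidth dep V F =
     (if infinite V \<or> infinite F \<or> F = {} then 0
      else if graph_connected dep V F then 1 + (MIN f\<in>F. hwidth dep V (F - {f}))
      else (MAX C\<in>graph_components dep V F. hwidth dep (Inl -` C) (Inr -` C)))"
  by pat_completeness auto

termination
proof (relation "Wellfounded.measure (\<lambda>(dep, V, F). card (V <+> F))", goal_cases)
  case 1
  show ?case by simp
next
  case (2 dep V F f)
  then show ?case by (auto intro!: psubset_card_mono)
next
  case (3 dep V F C)
  have "Inl -` C <+> Inr -` C = C"
    by (auto simp: Plus_def) (metis rangeI sum.exhaust)
  moreover have "card C < card (V <+> F)"
    using 3 graph_component_psubset[of C dep V F] by (intro psubset_card_mono) auto
  ultimately show ?case by simp
qed

declare hwidth.simps [simp del]

definition hierarchy_width :: "('v, 'a, 'f) factor_graph \<Rightarrow> nat" where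
  "hierarchy_width G = hwidth (depends_on G) (vars G) (factors G)"

text \<open>
  The limit \<open>card (vars G) \<rightarrow> \<infinity>\<close> within a class of factor graphs.
\<close>

definition growing_in ::
  "('v, 'a, 'f) factor_graph set \<Rightarrow> ('v, 'a, 'f) factor_graph filter" where
  "growing_in \<G> = inf (filtercomap (\<lambda>G. card (vars G)) at_top) (principal \<G>)"

end

theory Submission
  imports Defs
begin

text \<open>
  For a weight \<open>W\<close> on worlds let \<open>dev W A g\<close> be the \<open>W\<close>-sum of the squared deviation of \<open>g\<close> from
  its conditional expectation given the coordinates outside \<open>A\<close>. The chain has spectral gap at
  least \<open>1 / (n K)\<close> once \<open>dev W V g \<le> K * (\<Sum>v\<in>V. dev W {v} g)\<close>, and \<open>K = exp (h M)\<close> is obtained by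
  following the recursion for the hierarchy width. Deviations from a conditional expectation are
  minima, hence monotone in \<open>W\<close>, so deleting one factor costs only a factor \<open>exp M\<close>; over connected
  components deviations are subadditive (Efron--Stein). Since each step of the chain averages
  orthogonal projections, it is positive, and the \<open>\<chi>\<^sup>2\<close>-distance to stationarity contracts
  geometrically. The total variation estimate needs only half of the claimed number of steps,
  which absorbs the rounding to an integer time when \<open>n \<ge> 2\<close>; for \<open>n = 1\<close> a single step suffices.
\<close>

section \<open>Conditional averages on a finite product space with a positive weight\<close>

locale finite_product =
  fixes U :: "'v set" and S :: "'v \<Rightarrow> 'a set"
  assumes fin_U: "finite U"
    and fin_S: "\<And>v. v \<in> U \<Longrightarrow> finite (S v)"
    and nonempty_S: "\<And>v. v \<in> U \<Longrightarrow> S v \<noteq> {}"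
begin

definition points :: "('v \<Rightarrow> 'a) set" where
  "points = Pi\<^sub>E U S"

definition fibre :: "'v set \<Rightarrow> ('v \<Rightarrow> 'a) \<Rightarrow> ('v \<Rightarrow> 'a) set" where
  "fibre A x = {y \<in> points. \<forall>w\<in>U - A. y w = x w}"

text \<open>\<open>A\<close> collects the coordinates that \<open>f\<close> ignores, so the
  condition strengthens as \<open>A\<close> grows; it is not stochastic independence.\<close>

definition indep :: "'v set \<Rightarrow> (('v \<Rightarrow> 'a) \<Rightarrow> real) \<Rightarrow> bool" where
  "indep A f \<longleftrightarrow> (\<forall>x\<in>points. \<forall>y\<in>fibre A x. f y = f x)"

definition pos_weight :: "(('v \<Rightarrow> 'a) \<Rightarrow> real) \<Rightarrow> bool" where
  "pos_weight W \<longleftrightarrow> (\<forall>x\<in>points. 0 < W x)"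

text \<open>Conditional expectation in which \<open>A\<close> is the resampled block and its
  complement is conditioned on. Scaling \<open>W\<close> by a positive constant does not change it,
  so weights need not have total mass one.\<close>

definition avg :: "(('v \<Rightarrow> 'a) \<Rightarrow> real) \<Rightarrow> 'v set \<Rightarrow> (('v \<Rightarrow> 'a) \<Rightarrow> real) \<Rightarrow> ('v \<Rightarrow> 'a) \<Rightarrow> real" where
  "avg W A g x = (\<Sum>y\<in>fibre A x. W y * g y) / (\<Sum>y\<in>fibre A x. W y)"

definition ip :: "(('v \<Rightarrow> 'a) \<Rightarrow> real) \<Rightarrow> (('v \<Rightarrow> 'a) \<Rightarrow> real) \<Rightarrow> (('v \<Rightarrow> 'a) \<Rightarrow> real) \<Rightarrow> real" where
  "ip W f g = (\<Sum>x\<in>points. W x * f x * g x)"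

definition dev :: "(('v \<Rightarrow> 'a) \<Rightarrow> real) \<Rightarrow> 'v set \<Rightarrow> (('v \<Rightarrow> 'a) \<Rightarrow> real) \<Rightarrow> real" where
  "dev W A g = (\<Sum>x\<in>points. W x * (g x - avg W A g x)\<^sup>2)"

lemma finite_points: "finite points"
  unfolding points_def using fin_U fin_S by (rule finite_PiE)

lemma points_nonempty: "points \<noteq> {}"
  unfolding points_def by (simp add: PiE_eq_empty_iff nonempty_S)

lemma finite_fibre: "finite (fibre A x)"
  unfolding fibre_def using finite_points by simp

lemma fibre_subset: "fibre A x \<subseteq> points"
  unfolding fibre_def by blast

lemma fibre_refl: "x \<in> points \<Longrightarrow> x \<in> fibre A x"
  unfolding fibre_def by simp

lemma fibre_sym: "x \<in> points \<Longrightarrow> y \<in> fibre A x \<Longrightarrow> x \<in> fibre A y"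
  unfolding fibre_def by simp

lemma fibre_eq: "y \<in> fibre A x \<Longrightarrow> fibre A y = fibre A x"
  unfolding fibre_def by auto

lemma fibre_all: "U \<subseteq> A \<Longrightarrow> fibre A x = points"
  unfolding fibre_def by auto

lemma fibre_mono: "A \<subseteq> B \<Longrightarrow> fibre A x \<subseteq> fibre B x"
  unfolding fibre_def by auto

lemma mixed_in_points:
  "x \<in> points \<Longrightarrow> y \<in> points \<Longrightarrow> (\<lambda>w. if w \<in> A then y w else x w) \<in> points"
  unfolding points_def PiE_def extensional_def Pi_def by auto

lemma indepD: "indep A f \<Longrightarrow> x \<in> points \<Longrightarrow> y \<in> fibre A x \<Longrightarrow> f y = f x"
  unfolding indep_def by blast

text \<open>Change the coordinates in \<open>A\<close> first and the remaining ones in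
  \<open>B\<close> afterwards; the hybrid point \<open>z\<close> in between lies in the product
  again.\<close>

lemma indep_Un:
  assumes "indep A f" "indep B f"
  shows "indep (A \<union> B) f"
  unfolding indep_def
proof (intro ballI)
  fix x y assume x: "x \<in> points" and y: "y \<in> fibre (A \<union> B) x"
  define z where "z = (\<lambda>w. if w \<in> A then y w else x w)"
  have z: "z \<in> points"
    unfolding z_def using x y fibre_subset by (blast intro: mixed_in_points)
  have "z \<in> fibre A x" "y \<in> fibre B z"
    using y z unfolding fibre_def z_def by auto
  with assms x z show "f y = f x"
    by (metis indepD)
qed

lemma indep_empty: "indep {} f"
  unfolding indep_def fibre_def points_def 
  by (auto intro!: arg_cong[of _ _ f]) (metis PiE_ext)

lemma indep_UN:
  assumes "finite I" "\<And>i. i \<in> I \<Longrightarrow> indep (A i) f"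
  shows "indep (\<Union>i\<in>I. A i) f"
  using assms by (induction rule: finite_induct) (auto simp: indep_empty intro!: indep_Un)

lemma indep_singletons:
  "finite A \<Longrightarrow> (\<And>v. v \<in> A \<Longrightarrow> indep {v} f) \<Longrightarrow> indep A f"
  using indep_UN[of A "\<lambda>v. {v}" f] by simp

lemma indep_mono: "indep B f \<Longrightarrow> A \<subseteq> B \<Longrightarrow> indep A f"
  unfolding indep_def using fibre_mono by blast

lemma indep_const: "indep A (\<lambda>_. c)"
  unfolding indep_def by simp

lemma indep_mult: "indep A f \<Longrightarrow> indep A g \<Longrightarrow> indep A (\<lambda>x. f x * g x)"
  unfolding indep_def by simp

lemma indep_prod: "(\<And>i. i \<in> I \<Longrightarrow> indep A (f i)) \<Longrightarrow> indep A (\<lambda>x. \<Prod>i\<in>I. f i x)"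
  unfolding indep_def by (auto intro!: prod.cong)

lemma indep_sum: "(\<And>i. i \<in> I \<Longrightarrow> indep A (f i)) \<Longrightarrow> indep A (\<lambda>x. \<Sum>i\<in>I. f i x)"
  unfolding indep_def by (auto intro!: sum.cong)

lemma fibre_weight_pos:
  assumes "pos_weight W" "x \<in> points"
  shows "0 < (\<Sum>y\<in>fibre A x. W y)"
  using assms fibre_subset[of A x] fibre_refl[of x A] finite_fibre
  unfolding pos_weight_def by (intro sum_pos) auto

lemma avg_eq_on_fibre: "y \<in> fibre A x \<Longrightarrow> avg W A g y = avg W A g x"
  unfolding avg_def by (simp add: fibre_eq)

lemma indep_avg: "indep A (avg W A g)"
  unfolding indep_def by (simp add: avg_eq_on_fibre)

lemma avg_cong:
  assumes "\<And>y. y \<in> points \<Longrightarrow> W y = W' y" "\<And>y. y \<in> points \<Longrightarrow> g y = g' y"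
  shows "avg W A g x = avg W' A g' x"
proof -
  have "y \<in> fibre A x \<Longrightarrow> W y = W' y \<and> g y = g' y" for y
    using assms fibre_subset by blast
  then show ?thesis unfolding avg_def by (auto intro!: arg_cong2[of _ _ _ _ "(/)"] sum.cong)
qed

lemma avg_indep:
  assumes "pos_weight W" "indep A c" "x \<in> points"
  shows "avg W A c x = c x"
proof -
  have "(\<Sum>y\<in>fibre A x. W y * c y) = (\<Sum>y\<in>fibre A x. W y) * c x"
    unfolding sum_distrib_right using assms by (intro sum.cong) (auto dest: indepD)
  then show ?thesis
    using fibre_weight_pos[OF assms(1,3), of A] unfolding avg_def by simp
qed

lemma avg_lincomb: "avg W A (\<lambda>x. a * f x + b * g x) x = a * avg W A f x + b * avg W A g x"
  unfolding avg_def
  by (simp add: distrib_left sum.distrib add_divide_distrib sum_distrib_left mult.left_commute)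

lemma avg_diff: "avg W A (\<lambda>x. f x - g x) x = avg W A f x - avg W A g x"
  using avg_lincomb[of W A 1 f "-1" g] by simp

section \<open>The weighted inner product, with averages as orthogonal projections\<close>

lemma ip_cong:
  "(\<And>x. x \<in> points \<Longrightarrow> f x = f' x) \<Longrightarrow> (\<And>x. x \<in> points \<Longrightarrow> g x = g' x) \<Longrightarrow> ip W f g = ip W f' g'"
  unfolding ip_def by (intro sum.cong) auto

lemma ip_commute: "ip W f g = ip W g f"
  unfolding ip_def by (simp add: ac_simps)

lemma ip_self_nonneg: "pos_weight W \<Longrightarrow> 0 \<le> ip W f f"
  unfolding ip_def pos_weight_def by (intro sum_nonneg) (simp add: mult.assoc less_imp_le)

lemma ip_diff_right: "ip W f (\<lambda>x. g x - h x) = ip W f g - ip W f h"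
  unfolding ip_def by (simp add: right_diff_distrib sum_subtractf)

lemma ip_diff_left: "ip W (\<lambda>x. g x - h x) f = ip W g f - ip W h f"
  by (metis ip_commute ip_diff_right)

lemma ip_scale_right: "ip W f (\<lambda>x. c * g x) = c * ip W f g"
  unfolding ip_def by (simp add: sum_distrib_left ac_simps)

lemma ip_scale_left: "ip W (\<lambda>x. c * g x) f = c * ip W g f"
  by (metis ip_commute ip_scale_right)

text \<open>Both sides are the sum of \<open>W x * f x * W y * g y\<close>, divided by the mass of
  the fibre, over all pairs in a common fibre; lying in a common fibre is symmetric.\<close>

lemma ip_avg_swap: "ip W f (avg W A g) = ip W (avg W A f) g"
proof -
  define m where "m x = (\<Sum>y\<in>fibre A x. W y)" for x
  have "ip W f (avg W A g) = (\<Sum>x\<in>points. \<Sum>y\<in>fibre A x. W x * f x * W y * g y / m x)"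
    unfolding ip_def avg_def m_def by (simp add: sum_distrib_left sum_divide_distrib ac_simps)
  also have "\<dots> = (\<Sum>x\<in>points. \<Sum>y\<in>{y\<in>points. \<forall>w\<in>U-A. y w = x w}. W x * f x * W y * g y / m x)"
    by (simp add: fibre_def)
  also have "\<dots> = (\<Sum>y\<in>points. \<Sum>x\<in>{x\<in>points. \<forall>w\<in>U-A. y w = x w}. W x * f x * W y * g y / m x)"
    by (rule sum.swap_restrict[OF finite_points finite_points])
  also have "\<dots> = (\<Sum>y\<in>points. \<Sum>x\<in>fibre A y. W x * f x * W y * g y / m y)"
  proof (intro sum.cong refl)
    fix y assume "y \<in> points"
    show "{x\<in>points. \<forall>w\<in>U-A. y w = x w} = fibre A y"
      unfolding fibre_def by auto
    fix x assume "x \<in> fibre A y"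
    then show "W x * f x * W y * g y / m x = W x * f x * W y * g y / m y"
      unfolding m_def by (simp add: fibre_eq)
  qed
  also have "\<dots> = ip W (avg W A f) g"
    unfolding ip_def avg_def m_def
    by (simp add: sum_distrib_left sum_distrib_right sum_divide_distrib ac_simps)
  finally show ?thesis .
qed

text \<open>Self-adjointness together with idempotence: an average over \<open>A\<close> is fixed by
  averaging over \<open>A\<close> again.\<close>

lemma ip_avg_avg:
  assumes "pos_weight W"
  shows "ip W (avg W A f) (avg W A g) = ip W f (avg W A g)"
  unfolding ip_avg_swap[of W "avg W A f" A g, symmetric] ip_avg_swap[of W f A g]
  by (subst ip_avg_swap) (auto intro!: ip_cong avg_indep assms indep_avg)

lemma dev_eq_ip: "dev W A g = ip W (\<lambda>x. g x - avg W A g x) (\<lambda>x. g x - avg W A g x)"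
  unfolding dev_def ip_def by (simp add: power2_eq_square ac_simps)

lemma dev_nonneg: "pos_weight W \<Longrightarrow> 0 \<le> dev W A g"
  by (simp add: dev_eq_ip ip_self_nonneg)

lemma dev_eq: "pos_weight W \<Longrightarrow> dev W A g = ip W g g - ip W g (avg W A g)"
  unfolding dev_eq_ip
  by (simp add: ip_diff_left ip_diff_right ip_avg_avg ip_commute[of W "avg W A g" g])

text \<open>The residual \<open>g - avg W A g\<close> is orthogonal to every function that ignores
  \<open>A\<close>, in particular to \<open>avg W A g - c\<close>, so the cross term
  vanishes.\<close>

lemma pythagoras:
  assumes "pos_weight W" "indep A c"
  shows "ip W (\<lambda>x. g x - c x) (\<lambda>x. g x - c x) =
    dev W A g + ip W (\<lambda>x. avg W A g x - c x) (\<lambda>x. avg W A g x - c x)"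
proof -
  have c: "ip W f c = ip W (avg W A f) c" for f
    by (subst ip_avg_swap[symmetric]) (auto intro!: ip_cong avg_indep[OF assms, symmetric])
  show ?thesis
    using c[of g] ip_avg_avg[OF assms(1), of A g g]
    by (simp add: dev_eq[OF assms(1)] ip_diff_left ip_diff_right ip_commute[of W c g]
        ip_commute[of W c "avg W A g"])
qed

text \<open>The average is the best approximation among functions that ignore \<open>A\<close>. The
  competitor \<open>c\<close> may come from a different weight, which makes deviations under two
  weights comparable.\<close>

lemma dev_le:
  assumes "pos_weight W" "indep A c"
  shows "dev W A g \<le> (\<Sum>x\<in>points. W x * (g x - c x)\<^sup>2)"
  using pythagoras[OF assms, of g] ip_self_nonneg[OF assms(1), of "\<lambda>x. avg W A g x - c x"]
  unfolding ip_def by (simp add: power2_eq_square ac_simps)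

section \<open>Subadditivity of deviations and comparison of weights\<close>

lemma ip_avg_le:
  assumes "pos_weight W"
  shows "ip W (avg W A g) (avg W A g) \<le> ip W g g"
  using pythagoras[OF assms indep_const[of A 0], of g] dev_nonneg[OF assms, of A g] by simp

text \<open>Under the factorization, \<open>A\<close> and \<open>B\<close> are conditionally
  independent given the other coordinates: along a fibre of \<open>A\<close> the factor
  \<open>q\<close> is constant and cancels, and neither \<open>p\<close> nor \<open>g\<close> sees
  \<open>B\<close>.\<close>

lemma indep_avg_other:
  assumes pos: "pos_weight p" "pos_weight q" and W: "\<And>x. x \<in> points \<Longrightarrow> W x = p x * q x"
    and p: "indep B p" and q: "indep A q" and g: "indep B g" and disj: "A \<inter> B = {}"
  shows "indep B (avg W A g)"
proof -
  have red: "avg W A g x = avg p A g x" if x: "x \<in> points" for x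
  proof -
    have *: "W y = p y * q x" if "y \<in> fibre A x" for y
      using that x W q fibre_subset by (metis indepD subsetD)
    have "(\<Sum>y\<in>fibre A x. W y * g y) = (\<Sum>y\<in>fibre A x. p y * g y) * q x"
      unfolding sum_distrib_right by (intro sum.cong) (auto simp: *)
    moreover have "(\<Sum>y\<in>fibre A x. W y) = (\<Sum>y\<in>fibre A x. p y) * q x"
      unfolding sum_distrib_right by (intro sum.cong) (auto simp: *)
    moreover have "q x \<noteq> 0"
      using pos x unfolding pos_weight_def by force
    ultimately show ?thesis unfolding avg_def by simp
  qed
  show ?thesis
    unfolding indep_def
  proof (intro ballI)
    fix x x' assume x: "x \<in> points" and x': "x' \<in> fibre B x"
    have x'p: "x' \<in> points" using x' fibre_subset by blast
    \<comment> \<open>\<open>T z\<close> overwrites the \<open>B\<close>-coordinates by those of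
      \<open>z\<close>. Since \<open>A\<close> and \<open>B\<close> are disjoint,
      \<open>T x'\<close> and \<open>T x\<close> are inverse bijections between
      \<open>fibre A x\<close> and \<open>fibre A x'\<close>, and they move points only in
      directions that \<open>p\<close> and \<open>g\<close> ignore.\<close>
    define T where "T z y = (\<lambda>w. if w \<in> B then z w else y w)" for z y :: "'v \<Rightarrow> 'a"
    have Tp: "T z y \<in> points" if "z \<in> points" "y \<in> points" for z y
      unfolding T_def by (rule mixed_in_points[OF that(2) that(1)])
    have inv: "T z (T z' y) = y" if "y \<in> fibre A z" "z \<in> points" for z z' y
    proof
      fix w show "T z (T z' y) w = y w"
        using that disj unfolding T_def fibre_def points_def PiE_def extensional_def
        by (cases "w \<in> U"; cases "w \<in> A") (auto simp: disjoint_iff)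
    qed
    have maps: "T x' y \<in> fibre A x'" if "y \<in> fibre A x" for y
      using that Tp[OF x'p, of y] x' unfolding fibre_def T_def by auto
    have maps': "T x y \<in> fibre A x" if "y \<in> fibre A x'" for y
      using that Tp[OF x, of y] x' unfolding fibre_def T_def by auto
    have Tf: "T x' y \<in> fibre B y" if "y \<in> fibre A x" for y
      using maps[OF that] unfolding fibre_def T_def by auto
    have eq: "(\<Sum>y\<in>fibre A x'. f y) = (\<Sum>y\<in>fibre A x. f y)" if f: "indep B f" for f
    proof (rule sum.reindex_bij_witness[of _ "T x'" "T x"])
      fix y assume y: "y \<in> fibre A x'"
      show "T x' (T x y) = y" by (rule inv[OF y x'p])
      show "T x y \<in> fibre A x" by (rule maps'[OF y])
      have "f (T x' (T x y)) = f (T x y)"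
        using Tf[OF maps'[OF y]] fibre_subset maps'[OF y] f by (blast intro: indepD)
      then show "f (T x y) = f y" by (simp add: inv[OF y x'p])
    qed (auto intro: inv maps x)
    have "avg p A g x' = avg p A g x"
      unfolding avg_def using eq[OF p] eq[OF indep_mult[OF p g]] by simp
    then show "avg W A g x' = avg W A g x"
      by (simp add: red x x'p)
  qed
qed

text \<open>The iterated average \<open>c\<close> ignores both blocks. Then \<open>g - c\<close> is
  the orthogonal sum of \<open>g - avg W A g\<close> and the \<open>A\<close>-average of
  \<open>g - avg W B g\<close>; projecting can only shrink the latter.\<close>

lemma dev_Un_le:
  assumes pos: "pos_weight p" "pos_weight q" and W: "\<And>x. x \<in> points \<Longrightarrow> W x = p x * q x"
    and p: "indep B p" and q: "indep A q" and disj: "A \<inter> B = {}"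
  shows "dev W (A \<union> B) g \<le> dev W A g + dev W B g"
proof -
  have posW: "pos_weight W"
    using pos W unfolding pos_weight_def by simp
  define c where "c = avg W A (avg W B g)"
  have "indep (A \<union> B) c"
    unfolding c_def
    by (intro indep_Un indep_avg indep_avg_other[OF pos W p q indep_avg disj])
  then have "dev W (A \<union> B) g \<le> ip W (\<lambda>x. g x - c x) (\<lambda>x. g x - c x)"
    using dev_le[OF posW, of "A \<union> B" c g] unfolding ip_def by (simp add: power2_eq_square ac_simps)
  also have "\<dots> = dev W A g + ip W (\<lambda>x. avg W A g x - c x) (\<lambda>x. avg W A g x - c x)"
    by (rule pythagoras[OF posW]) (simp add: c_def indep_avg)
  also have "ip W (\<lambda>x. avg W A g x - c x) (\<lambda>x. avg W A g x - c x) =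
      ip W (avg W A (\<lambda>x. g x - avg W B g x)) (avg W A (\<lambda>x. g x - avg W B g x))"
    by (intro ip_cong) (simp_all add: avg_diff c_def)
  also have "\<dots> \<le> dev W B g"
    unfolding dev_eq_ip by (rule ip_avg_le[OF posW])
  finally show ?thesis by simp
qed

text \<open>Peel off one block at a time. The free factor \<open>u\<close> makes the induction work:
  it absorbs the factor \<open>p i\<close> of the block just removed, which ignores all remaining
  blocks.\<close>

lemma dev_UN_le:
  assumes "finite I" and W: "\<And>x. x \<in> points \<Longrightarrow> W x = u x * (\<Prod>i\<in>I. p i x)"
    and u: "pos_weight u" "indep (\<Union>i\<in>I. A i) u"
    and p: "\<And>i. i \<in> I \<Longrightarrow> pos_weight (p i)"
      "\<And>i j. i \<in> I \<Longrightarrow> j \<in> I \<Longrightarrow> i \<noteq> j \<Longrightarrow> indep (A j) (p i)"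
    and disj: "\<And>i j. i \<in> I \<Longrightarrow> j \<in> I \<Longrightarrow> i \<noteq> j \<Longrightarrow> A i \<inter> A j = {}"
  shows "dev W (\<Union>i\<in>I. A i) g \<le> (\<Sum>i\<in>I. dev W (A i) g)"
  using assms
proof (induction arbitrary: u rule: finite_induct)
  case empty
  have "pos_weight W" using empty unfolding pos_weight_def by simp
  from dev_le[OF this indep_empty[of g], of g] show ?case by simp
next
  case (insert i I)
  have 1: "dev W (\<Union>j\<in>I. A j) g \<le> (\<Sum>j\<in>I. dev W (A j) g)"
  proof (rule insert.IH[of "\<lambda>x. u x * p i x"])
    show "W x = u x * p i x * (\<Prod>i\<in>I. p i x)" if "x \<in> points" for x
      using insert that by simp
    show "pos_weight (\<lambda>x. u x * p i x)"
      using insert.prems(2) insert.prems(4)[of i] unfolding pos_weight_def by simp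
    show "indep (\<Union>j\<in>I. A j) (\<lambda>x. u x * p i x)"
      using insert.hyps insert.prems(5)[of i]
      by (intro indep_mult indep_UN indep_mono[OF insert.prems(3)]) auto
  qed (use insert in auto)
  have 2: "dev W ((\<Union>j\<in>I. A j) \<union> A i) g \<le> dev W (\<Union>j\<in>I. A j) g + dev W (A i) g"
  proof (rule dev_Un_le[of "\<lambda>x. u x * (\<Prod>i\<in>I. p i x)" "p i"])
    show "pos_weight (\<lambda>x. u x * (\<Prod>i\<in>I. p i x))"
      using insert.prems(2,4) unfolding pos_weight_def
      by (intro ballI mult_pos_pos prod_pos) auto
    show "W x = u x * (\<Prod>i\<in>I. p i x) * p i x" if "x \<in> points" for x
      using insert that by simp
    show "indep (A i) (\<lambda>x. u x * (\<Prod>i\<in>I. p i x))"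
      using insert.hyps insert.prems(5)
      by (intro indep_mult indep_prod indep_mono[OF insert.prems(3)]) auto
    show "indep (\<Union>j\<in>I. A j) (p i)"
      using insert.hyps insert.prems(5)[of i] by (intro indep_UN) auto
    show "(\<Union>j\<in>I. A j) \<inter> A i = {}"
      using insert.hyps insert.prems(6)[of i] by fastforce
  qed (use insert in auto)
  have "(\<Union>j\<in>insert i I. A j) = (\<Union>j\<in>I. A j) \<union> A i" by auto
  with 1 2 insert.hyps show ?case by simp
qed

text \<open>The average under \<open>W'\<close> is an admissible competitor for \<open>W\<close>, so
  the pointwise comparison of weights applies with the same squared function on both sides.\<close>

lemma dev_weight_mono:
  assumes "pos_weight W" "pos_weight W'" "0 \<le> c"
    and "\<And>x. x \<in> points \<Longrightarrow> W x \<le> c * W' x"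
  shows "dev W A g \<le> c * dev W' A g"
proof -
  have "dev W A g \<le> (\<Sum>x\<in>points. W x * (g x - avg W' A g x)\<^sup>2)"
    by (intro dev_le assms indep_avg)
  also have "\<dots> \<le> (\<Sum>x\<in>points. c * W' x * (g x - avg W' A g x)\<^sup>2)"
    using assms by (intro sum_mono mult_right_mono) auto
  also have "\<dots> = c * dev W' A g"
    unfolding dev_def by (simp add: sum_distrib_left ac_simps)
  finally show ?thesis .
qed

end

section \<open>Components of the bipartite graph and the recursion for hierarchy width\<close>

lemma hwidth_trivial: "infinite V \<or> infinite F \<or> F = {} \<Longrightarrow> hwidth dep V F = 0"
  by (subst hwidth.simps) simp

lemma hwidth_connected:
  assumes "finite V" "finite F" "F \<noteq> {}" "graph_connected dep V F"
  obtains f where "f \<in> F" "hwidth dep V F = Suc (hwidth dep V (F - {f}))"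
proof -
  let ?A = "(\<lambda>f. hwidth dep V (F - {f})) ` F"
  have "Min ?A \<in> ?A" using assms by (intro Min_in) auto
  then obtain f where "f \<in> F" "Min ?A = hwidth dep V (F - {f})" by auto
  moreover have "hwidth dep V F = Suc (Min ?A)"
    using assms by (subst hwidth.simps) simp
  ultimately show thesis using that by simp
qed

lemma finite_graph_components:
  "finite V \<Longrightarrow> finite F \<Longrightarrow> finite (graph_components dep V F)"
  unfolding graph_components_def quotient_def by simp

lemma hwidth_component_le:
  assumes "finite V" "finite F" "F \<noteq> {}" "\<not> graph_connected dep V F"
    and "C \<in> graph_components dep V F"
  shows "hwidth dep (Inl -` C) (Inr -` C) \<le> hwidth dep V F"
  using assms finite_graph_components[OF assms(1,2), of dep]
  by (subst (2) hwidth.simps) (auto intro!: Max_ge)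

lemma sym_graph_edges_rtrancl: "sym ((graph_edges dep V F)\<^sup>*)"
  by (rule sym_rtrancl) (auto simp: sym_def graph_edges_def)

lemma Union_graph_components: "\<Union> (graph_components dep V F) = V <+> F"
  using graph_component_subset[of _ dep V F]
  unfolding graph_components_def quotient_def by blast

lemma graph_components_disjoint:
  assumes "C \<in> graph_components dep V F" "D \<in> graph_components dep V F" "C \<noteq> D"
  shows "C \<inter> D = {}"
proof -
  let ?R = "(graph_edges dep V F)\<^sup>*"
  have "equiv UNIV ?R"
    by (intro equivI refl_rtrancl sym_graph_edges_rtrancl trans_rtrancl subset_UNIV) simp_all
  moreover have "C \<in> UNIV // ?R" "D \<in> UNIV // ?R"
    using assms unfolding graph_components_def quotient_def by blast+
  ultimately show ?thesis
    using quotient_disj assms(3) by blast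
qed

text \<open>An edge stays inside one equivalence class. Hence a factor of one component has no edge
  to the variables of another, which is the block structure that subadditivity needs.\<close>

lemma graph_component_closed:
  assumes "C \<in> graph_components dep V F" "v \<in> V" "f \<in> F" "dep f v"
  shows "Inl v \<in> C \<longleftrightarrow> Inr f \<in> C"
proof -
  have "(Inl v, Inr f) \<in> graph_edges dep V F" "(Inr f, Inl v) \<in> graph_edges dep V F"
    using assms unfolding graph_edges_def by auto
  then show ?thesis
    using assms(1) unfolding graph_components_def quotient_def
    by (auto intro: rtrancl_into_rtrancl)
qed

text \<open>In the disconnected case, follow the component of some factor. Positivity later bounds
  the maximum weight by its product with the hierarchy width.\<close>

lemma hwidth_pos:
  "finite V \<Longrightarrow> finite F \<Longrightarrow> F \<noteq> {} \<Longrightarrow> 0 < hwidth dep V F"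
proof (induction dep V F rule: hwidth.induct)
  case (1 dep V F)
  show ?case
  proof (cases "graph_connected dep V F")
    case True
    then show ?thesis using hwidth_connected[OF "1.prems"(1,2,3)] by (metis zero_less_Suc)
  next
    case False
    obtain f where "f \<in> F" using "1.prems" by blast
    then obtain C where C: "C \<in> graph_components dep V F" "Inr f \<in> C"
      using Union_graph_components[of dep V F] by blast
    have "Inl -` C \<subseteq> V" "Inr -` C \<subseteq> F"
      using graph_component_subset[OF C(1)] by auto
    then have "finite (Inl -` C)" "finite (Inr -` C)"
      using "1.prems" finite_subset by blast+
    then have "0 < hwidth dep (Inl -` C) (Inr -` C)"
      using C "1.prems" False by (intro "1.IH"(2)) auto
    then show ?thesis
      using hwidth_component_le[OF "1.prems" False C(1)] by simp
  qed
qed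

section \<open>The Poincare inequality along the hierarchy recursion\<close>

context finite_product
begin

text \<open>The ambient \<open>points\<close> stay fixed while \<open>V\<close> and \<open>F\<close>
  shrink, so coordinates outside \<open>V\<close> are merely conditioned on. The factor
  \<open>u\<close>, which ignores \<open>V\<close>, holds what the recursion moves out of
  \<open>F\<close>: constants and the potentials of other components.\<close>

lemma dev_le_hierarchy:
  fixes dep :: "'f \<Rightarrow> 'v \<Rightarrow> bool" and \<phi> :: "'f \<Rightarrow> ('v \<Rightarrow> 'a) \<Rightarrow> real"
  assumes "finite V" "finite F" "0 \<le> M"
    and "\<And>f x y. f \<in> F \<Longrightarrow> x \<in> points \<Longrightarrow> y \<in> points \<Longrightarrow> \<phi> f x - \<phi> f y \<le> M"
    and "\<And>f v. f \<in> F \<Longrightarrow> v \<in> V \<Longrightarrow> \<not> dep f v \<Longrightarrow> indep {v} (\<phi> f)"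
    and "pos_weight u" "indep V u"
    and "\<And>x. x \<in> points \<Longrightarrow> W x = u x * exp (\<Sum>f\<in>F. \<phi> f x)"
  shows "dev W V g \<le> exp (real (hwidth dep V F) * M) * (\<Sum>v\<in>V. dev W {v} g)"
  using assms
proof (induction dep V F arbitrary: u W rule: hwidth.induct)
  case (1 dep V F)
  note fin = "1.prems"(1,2) and M = "1.prems"(3) and bound = "1.prems"(4)
    and loc = "1.prems"(5) and u = "1.prems"(6,7) and W = "1.prems"(8)
  have posW: "pos_weight W"
    using u W unfolding pos_weight_def by simp
  have nn: "0 \<le> dev W A g" for A by (rule dev_nonneg[OF posW])
  show ?case
  proof (cases "F = {}")
    case True
    \<comment> \<open>With no factor left, \<open>W\<close> agrees with \<open>u\<close> on the
      points and ignores \<open>V\<close>: the coordinates are conditionally independent, and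
      subadditivity over singletons has constant one.\<close>
    have "dev W (\<Union>v\<in>V. {v}) g \<le> (\<Sum>v\<in>V. dev W {v} g)"
      using fin u W True
      by (intro dev_UN_le[where u = u and p = "\<lambda>_ _. 1"]) (auto simp: pos_weight_def indep_const)
    then show ?thesis using True by (simp add: hwidth_trivial)
  next
    case F: False
    show ?thesis
    proof (cases "graph_connected dep V F")
      case True
      then obtain f where f: "f \<in> F" "hwidth dep V F = Suc (hwidth dep V (F - {f}))"
        using hwidth_connected fin F by metis
      \<comment> \<open>Normalizing the removed factor at its minimum \<open>m\<close> keeps the
        ratio \<open>W x / W' x\<close> between \<open>1\<close> and \<open>exp M\<close>, so the
        removal costs \<open>exp M\<close> in total rather than once in each direction.\<close>
      obtain x0 where x0: "x0 \<in> points" "\<And>x. x \<in> points \<Longrightarrow> \<phi> f x0 \<le> \<phi> f x"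
        using ex_min_if_finite[of "\<phi> f ` points"] finite_points points_nonempty
        by (metis (no_types, lifting) arg_min_if_finite(1) arg_min_least)
      define m where "m = \<phi> f x0"
      define W' where "W' x = (u x * exp m) * exp (\<Sum>f\<in>F - {f}. \<phi> f x)" for x
      have WW': "W x = exp (\<phi> f x - m) * W' x" if "x \<in> points" for x
        unfolding W'_def W[OF that] sum.remove[OF fin(2) f(1)] by (simp add: exp_add exp_diff)
      have pos': "pos_weight W'"
        using u unfolding pos_weight_def W'_def by simp
      have IH: "dev W' V g \<le> exp (real (hwidth dep V (F - {f})) * M) * (\<Sum>v\<in>V. dev W' {v} g)"
      proof (rule "1.IH"(1)[where u = "\<lambda>x. u x * exp m"])
        show "pos_weight (\<lambda>x. u x * exp m)" using u by (simp add: pos_weight_def)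
        show "indep V (\<lambda>x. u x * exp m)" using u by (intro indep_mult indep_const)
      qed (use fin F True f M bound loc in \<open>auto simp: W'_def\<close>)
      have ge1: "1 * W' x \<le> W x" if "x \<in> points" for x
        using WW'[OF that] x0(2)[OF that] pos' that unfolding m_def pos_weight_def
        by (auto intro!: mult_right_mono less_imp_le)
      have leM: "W x \<le> exp M * W' x" if "x \<in> points" for x
        using WW'[OF that] bound[OF f(1) that x0(1)] pos' that unfolding m_def pos_weight_def
        by (auto intro!: mult_right_mono less_imp_le)
      have "dev W V g \<le> exp M * dev W' V g"
        using leM by (intro dev_weight_mono posW pos') auto
      also have "\<dots> \<le> exp M * (exp (real (hwidth dep V (F - {f})) * M) * (\<Sum>v\<in>V. dev W' {v} g))"
        using IH by (intro mult_left_mono) auto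
      also have "\<dots> = exp (real (hwidth dep V F) * M) * (\<Sum>v\<in>V. dev W' {v} g)"
        by (simp add: f(2) algebra_simps exp_add)
      \<comment> \<open>Returning from \<open>W'\<close> to \<open>W\<close> is free, since
        \<open>W'\<close> lies below \<open>W\<close>.\<close>
      also have "\<dots> \<le> exp (real (hwidth dep V F) * M) * (\<Sum>v\<in>V. dev W {v} g)"
        using dev_weight_mono[OF pos' posW, of 1] ge1
        by (intro mult_left_mono sum_mono) auto
      finally show ?thesis .
    next
      case False
      define I where "I = graph_components dep V F"
      define VC where "VC C = (Inl -` C :: 'v set)" for C :: "('v + 'f) set"
      define FC where "FC C = (Inr -` C :: 'f set)" for C :: "('v + 'f) set"
      define p where "p C x = exp (\<Sum>f\<in>FC C. \<phi> f x)" for C x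
      have finI: "finite I" unfolding I_def by (rule finite_graph_components[OF fin])
      have sub: "VC C \<subseteq> V" "FC C \<subseteq> F" if "C \<in> I" for C
        using graph_component_subset[of C dep V F] that unfolding VC_def FC_def I_def by auto
      have disj: "VC C \<inter> VC D = {}" "FC C \<inter> FC D = {}" if "C \<in> I" "D \<in> I" "C \<noteq> D" for C D
        using graph_components_disjoint[of C dep V F D] that unfolding VC_def FC_def I_def by auto
      have UV: "(\<Union>C\<in>I. VC C) = V" and UF: "(\<Union>C\<in>I. FC C) = F"
        using Union_graph_components[of dep V F] unfolding VC_def FC_def I_def by blast+
      have finC: "finite (VC C)" "finite (FC C)" if "C \<in> I" for C
        using sub[OF that] fin finite_subset by blast+
      have pp: "pos_weight (p C)" for C unfolding p_def pos_weight_def by simp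
      have indep_p: "indep (VC D) (p C)" if CD: "C \<in> I" "D \<in> I" "C \<noteq> D" for C D
      proof -
        have *: "indep {v} (\<phi> f)" if "v \<in> VC D" "f \<in> FC C" for v f
        proof (rule loc)
          show "f \<in> F" "v \<in> V" using that CD sub by blast+
          then show "\<not> dep f v"
            using graph_component_closed[of C dep V F v f] disj[OF CD] that CD
            unfolding VC_def FC_def I_def by blast
        qed
        have "indep (VC D) (\<lambda>x. \<Sum>f\<in>FC C. \<phi> f x)"
          by (rule indep_singletons[OF finC(1)[OF CD(2)]], rule indep_sum, rule *)
        then show ?thesis unfolding p_def indep_def by simp
      qed
      have Wp: "W x = u x * (\<Prod>C\<in>I. p C x)" if "x \<in> points" for x
      proof -
        have "(\<Sum>f\<in>F. \<phi> f x) = (\<Sum>C\<in>I. \<Sum>f\<in>FC C. \<phi> f x)"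
          unfolding UF[symmetric] using finI finC disj by (intro sum.UNION_disjoint) auto
        then show ?thesis
          unfolding W[OF that] p_def exp_sum[OF finI, symmetric] by simp
      qed
      have "dev W V g \<le> (\<Sum>C\<in>I. dev W (VC C) g)"
        using dev_UN_le[OF finI Wp u(1), of VC g] UV u(2) pp indep_p disj by simp
      also have "\<dots> \<le> (\<Sum>C\<in>I. exp (real (hwidth dep V F) * M) * (\<Sum>v\<in>VC C. dev W {v} g))"
      proof (intro sum_mono)
        fix C assume C: "C \<in> I"
        \<comment> \<open>Seen from \<open>C\<close>, the weights of all other components ignore its
          variables and join \<open>u\<close>.\<close>
        let ?u = "\<lambda>x. u x * (\<Prod>D\<in>I - {C}. p D x)"
        have "dev W (VC C) g \<le>
            exp (real (hwidth dep (VC C) (FC C)) * M) * (\<Sum>v\<in>VC C. dev W {v} g)"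
          unfolding VC_def FC_def
        proof (rule "1.IH"(2)[where u = ?u], unfold VC_def[symmetric] FC_def[symmetric])
          show "\<not> (infinite V \<or> infinite F \<or> F = {})" using fin F by simp
          show "\<not> graph_connected dep V F" by fact
          show "C \<in> graph_components dep V F" using C by (simp add: I_def)
          show "pos_weight ?u"
            using u pp unfolding pos_weight_def by (intro ballI mult_pos_pos prod_pos) auto
          show "indep (VC C) ?u"
            using C indep_p by (intro indep_mult indep_prod indep_mono[OF u(2) sub(1)]) auto
          show "W x = ?u x * exp (\<Sum>f\<in>FC C. \<phi> f x)" if "x \<in> points" for x
            unfolding Wp[OF that] prod.remove[OF finI C] by (simp add: p_def)
          show "indep {v} (\<phi> f)" if "f \<in> FC C" "v \<in> VC C" "\<not> dep f v" for f v
            using that sub[OF C] by (intro loc) auto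
        qed (use finC[OF C] sub[OF C] M bound in auto)
        also have "\<dots> \<le> exp (real (hwidth dep V F) * M) * (\<Sum>v\<in>VC C. dev W {v} g)"
          using hwidth_component_le[OF fin F False, of C] C M nn
          unfolding VC_def FC_def I_def
          by (intro mult_right_mono sum_nonneg) (auto intro: mult_right_mono)
        finally show "dev W (VC C) g \<le> \<dots>" .
      qed
      also have "\<dots> = exp (real (hwidth dep V F) * M) * (\<Sum>v\<in>V. dev W {v} g)"
        unfolding UV[symmetric] sum_distrib_left[symmetric]
        using finI finC disj by (subst sum.UNION_disjoint) auto
      finally show ?thesis .
    qed
  qed
qed

section \<open>The one-step operator of the random-scan sampler and its contraction\<close>

definition sampler :: "(('v \<Rightarrow> 'a) \<Rightarrow> real) \<Rightarrow> (('v \<Rightarrow> 'a) \<Rightarrow> real) \<Rightarrow> ('v \<Rightarrow> 'a) \<Rightarrow> real" where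
  "sampler W g x = (\<Sum>v\<in>U. avg W {v} g x) / card U"

lemma sampler_lincomb: "sampler W (\<lambda>x. a * f x + b * g x) x = a * sampler W f x + b * sampler W g x"
  unfolding sampler_def
  by (simp add: avg_lincomb sum.distrib add_divide_distrib sum_distrib_left)

lemma sampler_diff: "sampler W (\<lambda>x. f x - g x) x = sampler W f x - sampler W g x"
  using sampler_lincomb[of W 1 f "-1" g] by simp

lemma sampler_const: "pos_weight W \<Longrightarrow> U \<noteq> {} \<Longrightarrow> x \<in> points \<Longrightarrow> sampler W (\<lambda>_. c) x = c"
  unfolding sampler_def using fin_U by (simp add: avg_indep indep_const)

lemma ip_sampler: "ip W f (sampler W g) = (\<Sum>v\<in>U. ip W f (avg W {v} g)) / card U"
proof -
  have "ip W f (sampler W g) = (\<Sum>x\<in>points. \<Sum>v\<in>U. W x * f x * avg W {v} g x / card U)"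
    unfolding ip_def sampler_def by (simp add: sum_distrib_left sum_divide_distrib)
  also have "\<dots> = (\<Sum>v\<in>U. \<Sum>x\<in>points. W x * f x * avg W {v} g x / card U)"
    by (rule sum.swap)
  finally show ?thesis
    unfolding ip_def by (simp add: sum_divide_distrib)
qed

lemma ip_sampler_swap: "ip W f (sampler W g) = ip W (sampler W f) g"
  unfolding ip_sampler ip_commute[of W "sampler W f" g]
  by (metis (no_types, lifting) ip_avg_swap ip_commute sum.cong)

text \<open>Each \<open>avg W {v}\<close> is an orthogonal projection, so its quadratic form is the
  squared norm of the image; the random choice of \<open>v\<close> averages these.\<close>

lemma ip_sampler_nonneg:
  assumes "pos_weight W"
  shows "0 \<le> ip W f (sampler W f)"
proof -
  have "0 \<le> ip W f (avg W {v} f)" for v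
    using ip_self_nonneg[OF assms, of "avg W {v} f"] by (simp only: ip_avg_avg[OF assms])
  then show ?thesis
    unfolding ip_sampler by (simp add: sum_nonneg)
qed

text \<open>For \<open>g\<close> of mean zero, \<open>dev W U g\<close> is the full squared norm,
  while the one-coordinate deviations averaged over \<open>v\<close> give the Dirichlet form
  \<open>ip W g g - ip W g (sampler W g)\<close>. The Poincare inequality is thus a spectral gap of
  \<open>1 / (K * card U)\<close>.\<close>

lemma ip_sampler_le:
  assumes "pos_weight W" "U \<noteq> {}" "0 < K"
    and poincare: "dev W U g \<le> K * (\<Sum>v\<in>U. dev W {v} g)"
    and mean: "(\<Sum>x\<in>points. W x * g x) = 0"
  shows "ip W g (sampler W g) \<le> (1 - 1 / (K * card U)) * ip W g g"
proof -
  have n: "0 < real (card U)" using assms fin_U by (simp add: card_gt_0_iff)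
  have "avg W U g x = 0" for x
    unfolding avg_def fibre_all[OF order_refl] mean by simp
  then have "ip W g g = dev W U g" unfolding dev_eq_ip by simp
  then have le: "ip W g g / K \<le> (\<Sum>v\<in>U. dev W {v} g)"
    using poincare assms(3) by (simp add: field_simps)
  have "ip W g (sampler W g) = (\<Sum>v\<in>U. ip W g g - dev W {v} g) / card U"
    unfolding ip_sampler by (simp add: dev_eq[OF assms(1)])
  also have "\<dots> = ip W g g - (\<Sum>v\<in>U. dev W {v} g) / card U"
    using n by (simp add: sum_subtractf field_simps)
  also have "\<dots> \<le> ip W g g - (ip W g g / K) / card U"
    using le n by (intro diff_left_mono divide_right_mono) auto
  finally show ?thesis by (simp add: left_diff_distrib)
qed

text \<open>
  Positivity of the sampler replaces a diagonalisation: expanding the nonnegative form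
  \<open>\<langle>r g - P g, P (r g - P g)\<rangle>\<close> turns the bound \<open>\<rho>\<close> on the form into one on the norm of \<open>P g\<close>.
\<close>

lemma sampler_contraction:
  assumes W: "pos_weight W" and "0 \<le> \<rho>"
    and le: "\<And>g. (\<Sum>x\<in>points. W x * g x) = 0 \<Longrightarrow> ip W g (sampler W g) \<le> \<rho> * ip W g g"
    and mean: "(\<Sum>x\<in>points. W x * g x) = 0"
    and mean': "(\<Sum>x\<in>points. W x * sampler W g x) = 0"
  shows "ip W (sampler W g) (sampler W g) \<le> \<rho>\<^sup>2 * ip W g g"
proof -
  let ?P = "sampler W g"
  define N R where "N = ip W g g" and "R = ip W ?P ?P"
  have gg: "ip W g ?P \<le> \<rho> * N" and pp: "ip W ?P (sampler W ?P) \<le> \<rho> * R"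
    using le[OF mean] le[OF mean'] unfolding N_def R_def .
  have R0: "0 \<le> R" unfolding R_def by (rule ip_self_nonneg[OF W])
  have key: "0 \<le> r\<^sup>2 * ip W g ?P - 2 * r * R + ip W ?P (sampler W ?P)" for r
  proof -
    let ?f = "\<lambda>x. r * g x - ?P x"
    have Pf: "sampler W ?f x = r * ?P x - sampler W ?P x" for x
      using sampler_lincomb[of W r g "-1" ?P] by simp
    have "0 \<le> ip W ?f (sampler W ?f)" by (rule ip_sampler_nonneg[OF W])
    also have "\<dots> = ip W ?f (\<lambda>x. r * ?P x - sampler W ?P x)"
      by (intro ip_cong) (simp_all add: Pf)
    also have "\<dots> = r\<^sup>2 * ip W g ?P - 2 * r * R + ip W ?P (sampler W ?P)"
      unfolding R_def ip_diff_left ip_diff_right ip_scale_left ip_scale_right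
        ip_sampler_swap[of W g ?P]
      by (simp add: power2_eq_square algebra_simps)
    finally show ?thesis .
  qed
  show ?thesis
  proof (cases "\<rho> = 0")
    \<comment> \<open>Here \<open>r = \<rho>\<close> gives no information, so \<open>r = 1\<close>
      is used: both outer terms of \<open>key\<close> are nonpositive and force \<open>R\<close> to
      vanish.\<close>
    case True
    then have "R \<le> 0" using key[of 1] gg pp by simp
    then show ?thesis using True unfolding R_def by simp
  next
    case False
    have "0 \<le> \<rho>\<^sup>2 * (\<rho> * N) - 2 * \<rho> * R + \<rho> * R"
      using key[of \<rho>] pp mult_left_mono[OF gg zero_le_power2[of \<rho>]] by linarith
    then have "\<rho> * R \<le> \<rho> * (\<rho>\<^sup>2 * N)" by (simp add: algebra_simps)
    then show ?thesis using False assms(2) unfolding N_def R_def by simp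
  qed
qed

text \<open>Stationarity of \<open>W\<close>: pair with the constant function \<open>1\<close>,
  which the self-adjoint operator fixes.\<close>

lemma sampler_mean:
  assumes "pos_weight W" "U \<noteq> {}"
  shows "(\<Sum>x\<in>points. W x * sampler W g x) = (\<Sum>x\<in>points. W x * g x)"
proof -
  have "ip W (\<lambda>_. 1) (sampler W g) = ip W (sampler W (\<lambda>_. 1)) g"
    by (rule ip_sampler_swap)
  also have "\<dots> = ip W (\<lambda>_. 1) g"
    by (intro ip_cong) (simp_all add: sampler_const assms)
  finally show ?thesis unfolding ip_def by simp
qed

lemma sampler_iterate:
  assumes W: "pos_weight W" "U \<noteq> {}" and K: "1 \<le> K"
    and poincare: "\<And>g. dev W U g \<le> K * (\<Sum>v\<in>U. dev W {v} g)"
    and mean: "(\<Sum>x\<in>points. W x * g x) = 0"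
  shows "ip W ((sampler W ^^ t) g) ((sampler W ^^ t) g) \<le> ((1 - 1 / (K * card U)) ^ t)\<^sup>2 * ip W g g"
proof -
  let ?\<rho> = "1 - 1 / (K * card U)"
  have "1 \<le> card U" using W fin_U by (simp add: Suc_leI card_gt_0_iff)
  then have "1 * 1 \<le> K * card U" using K by (intro mult_mono) auto
  then have \<rho>: "0 \<le> ?\<rho>" by simp
  have m: "(\<Sum>x\<in>points. W x * (sampler W ^^ t) g x) = 0" for t
    by (induction t) (simp_all add: mean sampler_mean W)
  show ?thesis
  proof (induction t)
    case 0
    show ?case by simp
  next
    case (Suc t)
    let ?h = "(sampler W ^^ t) g"
    have "ip W (sampler W ?h) (sampler W ?h) \<le> ?\<rho>\<^sup>2 * ip W ?h ?h"
      using ip_sampler_le[OF W _ poincare] K m[of t] m[of "Suc t"] \<rho>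
      by (intro sampler_contraction W) auto
    also have "\<dots> \<le> ?\<rho>\<^sup>2 * ((?\<rho> ^ t)\<^sup>2 * ip W g g)"
      using Suc by (intro mult_left_mono) auto
    finally show ?case by (simp add: power_mult_distrib ac_simps)
  qed
qed

text \<open>Zero mean makes the contributions of \<open>A\<close> and its complement cancel, so
  twice either one is at most the weighted L1 norm of \<open>d\<close>. Cauchy-Schwarz against total
  weight one passes to the L2 norm.\<close>

lemma total_variation_le:
  assumes W: "pos_weight W" "(\<Sum>x\<in>points. W x) = 1"
    and mean: "(\<Sum>x\<in>points. W x * d x) = 0" and A: "A \<subseteq> points"
  shows "\<bar>\<Sum>x\<in>A. W x * d x\<bar> \<le> sqrt (ip W d d) / 2"
proof -
  have "(\<Sum>x\<in>points. W x * d x) = (\<Sum>x\<in>points - A. W x * d x) + (\<Sum>x\<in>A. W x * d x)"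
    by (rule sum.subset_diff[OF A finite_points])
  then have "2 * \<bar>\<Sum>x\<in>A. W x * d x\<bar> = \<bar>\<Sum>x\<in>points - A. W x * d x\<bar> + \<bar>\<Sum>x\<in>A. W x * d x\<bar>"
    using mean by linarith
  also have "\<dots> \<le> (\<Sum>x\<in>points - A. \<bar>W x * d x\<bar>) + (\<Sum>x\<in>A. \<bar>W x * d x\<bar>)"
    by (intro add_mono sum_abs)
  also have "\<dots> = (\<Sum>x\<in>points. \<bar>W x * d x\<bar>)"
    by (rule sum.subset_diff[OF A finite_points, symmetric])
  also have "\<dots> = (\<Sum>x\<in>points. \<bar>sqrt (W x) * (sqrt (W x) * d x)\<bar>)"
    using W(1) unfolding pos_weight_def
    by (intro sum.cong) (auto simp: mult.assoc[symmetric] less_imp_le)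
  also have "\<dots> = (\<Sum>x\<in>points. \<bar>sqrt (W x)\<bar> * \<bar>sqrt (W x) * d x\<bar>)"
    by (simp only: abs_mult)
  also have "\<dots> \<le> L2_set (\<lambda>x. sqrt (W x)) points * L2_set (\<lambda>x. sqrt (W x) * d x) points"
    by (rule L2_set_mult_ineq)
  also have "L2_set (\<lambda>x. sqrt (W x)) points = 1"
    unfolding L2_set_def using W unfolding pos_weight_def
    by (simp add: less_imp_le)
  also have "L2_set (\<lambda>x. sqrt (W x) * d x) points = sqrt (ip W d d)"
    unfolding L2_set_def ip_def using W(1) unfolding pos_weight_def
    by (intro arg_cong[of _ _ sqrt] sum.cong)
      (auto simp: power_mult_distrib power2_eq_square less_imp_le mult.assoc[symmetric])
  finally show ?thesis by simp
qed

lemma sampler_cong: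
  assumes "\<And>y. y \<in> points \<Longrightarrow> g y = g' y"
  shows "sampler W g x = sampler W g' x"
  unfolding sampler_def using assms by (simp cong: avg_cong)

lemma sampler_iterate_diff_const:
  assumes "pos_weight W" "U \<noteq> {}" "x \<in> points"
  shows "(sampler W ^^ t) (\<lambda>y. g y - c) x = (sampler W ^^ t) g x - c"
  using assms(3)
proof (induction t arbitrary: x)
  case (Suc t)
  have "sampler W ((sampler W ^^ t) (\<lambda>y. g y - c)) x = sampler W (\<lambda>y. (sampler W ^^ t) g y - c) x"
    by (rule sampler_cong) (rule Suc.IH)
  then show ?case
    using Suc.prems by (simp add: sampler_diff sampler_const[OF assms(1,2)])
qed simp

end

section \<open>The Gibbs chain in terms of densities\<close>

locale gibbs_chain =
  fixes G :: "('v, 'a, 'f) factor_graph"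
  assumes factor_graph: "is_factor_graph G"

sublocale gibbs_chain \<subseteq> finite_product "vars G" "states G"
  using factor_graph unfolding is_factor_graph_def by unfold_locales auto

context gibbs_chain
begin

abbreviation W :: "('v \<Rightarrow> 'a) \<Rightarrow> real" where
  "W \<equiv> pmf (gibbs_distribution G)"

lemma finite_factors: "finite (factors G)"
  using factor_graph unfolding is_factor_graph_def by simp

lemma worlds_eq: "worlds G = points"
  unfolding worlds_def points_def ..

lemma partition_constant_pos: "0 < partition_constant G"
  unfolding partition_constant_def worlds_eq
  using finite_points points_nonempty by (intro sum_pos) auto

lemma pmf_gibbs_distribution:
  "W x = (if x \<in> points then exp (energy G x) / partition_constant G else 0)"
  unfolding gibbs_distribution_def worlds_eq
proof (rule pmf_embed_pmf)
  show "0 \<le> (if x \<in> points then exp (energy G x) / partition_constant G else 0)" for x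
    using partition_constant_pos by simp
  have "(\<integral>\<^sup>+ x. ennreal (if x \<in> points then exp (energy G x) / partition_constant G else 0)
        \<partial>count_space UNIV) = (\<Sum>x\<in>points. ennreal (exp (energy G x) / partition_constant G))"
    by (subst nn_integral_count_space'[OF finite_points]) (auto intro!: sum.cong)
  also have "\<dots> = ennreal (\<Sum>x\<in>points. exp (energy G x) / partition_constant G)"
    using partition_constant_pos by (intro sum_ennreal) simp
  also have "\<dots> = 1"
    using partition_constant_pos
    by (simp add: sum_divide_distrib[symmetric] partition_constant_def worlds_eq)
  finally show "(\<integral>\<^sup>+ x. ennreal (if x \<in> points then exp (energy G x) / partition_constant G else 0)
        \<partial>count_space UNIV) = 1" .
qed

lemma pos_weight_gibbs: "pos_weight W"
  unfolding pos_weight_def pmf_gibbs_distribution using partition_constant_pos by simp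

lemma gibbs_pos: "x \<in> points \<Longrightarrow> 0 < W x"
  using pos_weight_gibbs unfolding pos_weight_def by simp

lemma set_gibbs_distribution: "set_pmf (gibbs_distribution G) = points"
  unfolding set_pmf_eq using gibbs_pos by (auto simp: pmf_gibbs_distribution)

lemma sum_pmf_points: "set_pmf p \<subseteq> points \<Longrightarrow> (\<Sum>x\<in>points. pmf p x) = 1"
  using sum_pmf_eq_1[OF finite_points] by simp

lemma
  assumes "x \<in> points"
  shows set_gibbs_resample:
      "set_pmf (cond_pmf (gibbs_distribution G) {J. \<forall>w\<in>vars G - {v}. J w = x w}) = fibre {v} x"
    and pmf_gibbs_resample:
      "pmf (cond_pmf (gibbs_distribution G) {J. \<forall>w\<in>vars G - {v}. J w = x w}) y =
        (if y \<in> fibre {v} x then W y / (\<Sum>z\<in>fibre {v} x. W z) else 0)"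
proof -
  let ?S = "{J. \<forall>w\<in>vars G - {v}. J w = x w}"
  have eq: "set_pmf (gibbs_distribution G) \<inter> ?S = fibre {v} x"
    unfolding set_gibbs_distribution fibre_def by auto
  \<comment> \<open>\<open>cond_pmf\<close> is specified only for events that meet the support; the
    current world \<open>x\<close> is a witness.\<close>
  have ne: "set_pmf (gibbs_distribution G) \<inter> ?S \<noteq> {}"
    unfolding eq using fibre_refl[OF assms] by blast
  show "set_pmf (cond_pmf (gibbs_distribution G) ?S) = fibre {v} x"
    by (simp only: set_cond_pmf[OF ne] eq)
  have "measure_pmf.prob (gibbs_distribution G) ?S = measure_pmf.prob (gibbs_distribution G) (fibre {v} x)"
    unfolding eq[symmetric] by (subst Int_commute) (rule measure_Int_set_pmf[symmetric])
  then have m: "measure_pmf.prob (gibbs_distribution G) ?S = (\<Sum>z\<in>fibre {v} x. W z)"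
    by (simp add: measure_measure_pmf_finite finite_fibre)
  show "pmf (cond_pmf (gibbs_distribution G) ?S) y =
      (if y \<in> fibre {v} x then W y / (\<Sum>z\<in>fibre {v} x. W z) else 0)"
    unfolding pmf_cond[OF ne] m
    by (auto simp: fibre_def pmf_gibbs_distribution)
qed

lemma set_gibbs_step:
  assumes "vars G \<noteq> {}" "x \<in> points"
  shows "set_pmf (gibbs_step G x) \<subseteq> points"
  unfolding gibbs_step_def set_bind_pmf set_gibbs_resample[OF assms(2)] using fibre_subset by blast

text \<open>Reversibility enters here: the fibres are symmetric in their two points.\<close>

lemma pmf_bind_gibbs_step:
  assumes ne: "vars G \<noteq> {}" and \<nu>: "set_pmf \<nu> \<subseteq> points" and y: "y \<in> points"
  shows "pmf (bind_pmf \<nu> (gibbs_step G)) y = W y * sampler W (\<lambda>x. pmf \<nu> x / W x) y"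
proof -
  let ?n = "real (card (vars G))"
  let ?m = "\<lambda>v x. \<Sum>z\<in>fibre {v} x. W z"
  have step: "pmf (gibbs_step G x) y =
      (\<Sum>v\<in>vars G. if y \<in> fibre {v} x then W y / ?m v x else 0) / ?n" if "x \<in> points" for x
    unfolding gibbs_step_def pmf_bind_pmf_of_set[OF ne fin_U] pmf_gibbs_resample[OF that] ..
  have "pmf (bind_pmf \<nu> (gibbs_step G)) y = (\<Sum>x\<in>points. pmf \<nu> x * pmf (gibbs_step G x) y)"
    unfolding pmf_bind using \<nu> by (subst integral_measure_pmf[OF finite_points]) auto
  also have "\<dots> = (\<Sum>x\<in>points. \<Sum>v\<in>vars G.
      (if y \<in> fibre {v} x then W y * (pmf \<nu> x / ?m v x) / ?n else 0))"
    by (intro sum.cong)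
      (auto simp: step sum_distrib_left sum_divide_distrib intro!: sum.cong)
  also have "\<dots> = (\<Sum>v\<in>vars G. \<Sum>x\<in>points.
      (if y \<in> fibre {v} x then W y * (pmf \<nu> x / ?m v x) / ?n else 0))"
    by (rule sum.swap)
  also have "\<dots> = (\<Sum>v\<in>vars G. W y * avg W {v} (\<lambda>x. pmf \<nu> x / W x) y / ?n)"
  proof (rule sum.cong[OF refl])
    fix v
    have "(\<Sum>x\<in>points. if y \<in> fibre {v} x then W y * (pmf \<nu> x / ?m v x) / ?n else 0) =
        (\<Sum>x\<in>fibre {v} y. W y * (pmf \<nu> x / ?m v x) / ?n)"
      using fibre_sym[OF y] fibre_sym[of _ y] finite_points fibre_subset[of "{v}" y]
      by (intro sum.mono_neutral_cong_right) auto
    also have "\<dots> = (\<Sum>x\<in>fibre {v} y. W y * (pmf \<nu> x / ?m v y) / ?n)"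
      by (intro sum.cong) (auto simp: fibre_eq)
    also have "\<dots> = W y * ((\<Sum>x\<in>fibre {v} y. pmf \<nu> x) / ?m v y) / ?n"
      by (simp add: sum_distrib_left sum_divide_distrib)
    also have "(\<Sum>x\<in>fibre {v} y. pmf \<nu> x) = (\<Sum>x\<in>fibre {v} y. W x * (pmf \<nu> x / W x))"
    proof (rule sum.cong[OF refl])
      fix x assume "x \<in> fibre {v} y"
      then have "0 < W x" using fibre_subset gibbs_pos by blast
      then show "pmf \<nu> x = W x * (pmf \<nu> x / W x)" by simp
    qed
    finally show "(\<Sum>x\<in>points. if y \<in> fibre {v} x then W y * (pmf \<nu> x / ?m v x) / ?n else 0) =
        W y * avg W {v} (\<lambda>x. pmf \<nu> x / W x) y / ?n"
      unfolding avg_def .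
  qed
  finally show ?thesis
    unfolding sampler_def by (simp add: sum_distrib_left sum_divide_distrib)
qed

text \<open>By reversibility, densities relative to the stationary law evolve under the same
  operator that acts on functions. The support is carried along because the one-step formula
  requires it.\<close>

lemma gibbs_law_density:
  assumes ne: "vars G \<noteq> {}" and \<mu>: "set_pmf \<mu> \<subseteq> points"
  shows "set_pmf (gibbs_law G \<mu> t) \<subseteq> points \<and>
    (\<forall>y\<in>points. pmf (gibbs_law G \<mu> t) y = W y * (sampler W ^^ t) (\<lambda>x. pmf \<mu> x / W x) y)"
proof (induction t)
  case 0
  show ?case
    using \<mu> gibbs_pos unfolding gibbs_law_def by (auto simp: less_imp_neq[symmetric])
next
  case (Suc t)
  let ?\<nu> = "gibbs_law G \<mu> t"
  have law: "gibbs_law G \<mu> (Suc t) = bind_pmf ?\<nu> (gibbs_step G)"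
    unfolding gibbs_law_def by simp
  have "set_pmf (bind_pmf ?\<nu> (gibbs_step G)) \<subseteq> points"
    using Suc set_gibbs_step[OF ne] by auto
  moreover have "pmf (bind_pmf ?\<nu> (gibbs_step G)) y =
      W y * sampler W ((sampler W ^^ t) (\<lambda>x. pmf \<mu> x / W x)) y" if "y \<in> points" for y
  proof -
    have "pmf ?\<nu> x / W x = (sampler W ^^ t) (\<lambda>x. pmf \<mu> x / W x) x" if "x \<in> points" for x
      using Suc that gibbs_pos[OF that] by simp
    then show ?thesis
      using Suc that by (simp add: pmf_bind_gibbs_step[OF ne] cong: sampler_cong)
  qed
  ultimately show ?case unfolding law by simp
qed

text \<open>Expand the square of the chi-square distance, then bound one of the two copies of
  \<open>pmf \<mu> x\<close> by \<open>1\<close> and \<open>1 / W x\<close> by \<open>B\<close>. The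
  resulting sum is \<open>B - 1\<close>, weakened to \<open>B\<close>.\<close>

lemma initial_distance:
  assumes \<mu>: "set_pmf \<mu> \<subseteq> points" and B: "\<And>x. x \<in> points \<Longrightarrow> 1 / W x \<le> B"
  shows "ip W (\<lambda>x. pmf \<mu> x / W x - 1) (\<lambda>x. pmf \<mu> x / W x - 1) \<le> B"
proof -
  have "W x * (pmf \<mu> x / W x - 1) * (pmf \<mu> x / W x - 1) \<le> B * pmf \<mu> x - 2 * pmf \<mu> x + W x"
    if "x \<in> points" for x
  proof -
    have "W x * (pmf \<mu> x / W x - 1) * (pmf \<mu> x / W x - 1) =
        (1 / W x) * (pmf \<mu> x * pmf \<mu> x) - 2 * pmf \<mu> x + W x"
      using gibbs_pos[OF that] by (simp add: field_simps)
    also have "(1 / W x) * (pmf \<mu> x * pmf \<mu> x) \<le> B * (pmf \<mu> x * 1)"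
      using order_trans[OF _ B[OF that], of 0] gibbs_pos[OF that]
      by (intro mult_mono B that pmf_le_1) auto
    finally show ?thesis using gibbs_pos[OF that] by simp
  qed
  then have "ip W (\<lambda>x. pmf \<mu> x / W x - 1) (\<lambda>x. pmf \<mu> x / W x - 1) \<le>
      (\<Sum>x\<in>points. B * pmf \<mu> x - 2 * pmf \<mu> x + W x)"
    unfolding ip_def by (rule sum_mono)
  also have "\<dots> = B - 2 + 1"
    using \<mu> set_gibbs_distribution
    by (simp add: sum.distrib sum_subtractf sum_distrib_left[symmetric] sum_pmf_points)
  finally show ?thesis by simp
qed

text \<open>The contraction is applied to the centred initial density. Total variation is at most
  half the norm of the density difference, so the threshold \<open>1 / 2\<close> gives the required
  \<open>1 / 4\<close>.\<close>

lemma mixed_at_if: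
  assumes ne: "vars G \<noteq> {}" and K: "1 \<le> K"
    and poincare: "\<And>g. dev W (vars G) g \<le> K * (\<Sum>v\<in>vars G. dev W {v} g)"
    and B: "\<And>x. x \<in> points \<Longrightarrow> 1 / W x \<le> B"
    and t: "(1 - 1 / (K * card (vars G))) ^ t * sqrt B \<le> 1 / 2"
  shows "mixed_at G t"
  unfolding mixed_at_def worlds_eq
proof (intro allI impI)
  fix \<mu> assume \<mu>: "set_pmf \<mu> \<subseteq> points"
  let ?\<nu> = "gibbs_law G \<mu> t"
  let ?\<rho> = "1 - 1 / (K * card (vars G))"
  have sums: "(\<Sum>x\<in>points. W x) = 1" "(\<Sum>x\<in>points. pmf \<mu> x) = 1" "(\<Sum>x\<in>points. pmf ?\<nu> x) = 1"
    using \<mu> set_gibbs_distribution gibbs_law_density[OF ne \<mu>]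
    by (simp_all only: sum_pmf_points order_refl)
  define d0 where "d0 x = pmf \<mu> x / W x - 1" for x
  define d where "d = (sampler W ^^ t) d0"
  have W0: "W x \<noteq> 0" if "x \<in> points" for x
    using gibbs_pos[OF that] by simp
  have d: "W x * d x = pmf ?\<nu> x - W x" if "x \<in> points" for x
    using gibbs_law_density[OF ne \<mu>, of t] that
    unfolding d_def d0_def sampler_iterate_diff_const[OF pos_weight_gibbs ne that]
    by (simp add: right_diff_distrib)
  have mean0: "(\<Sum>x\<in>points. W x * d0 x) = 0"
    unfolding d0_def using W0 sums by (simp add: right_diff_distrib sum_subtractf)
  have mean: "(\<Sum>x\<in>points. W x * d x) = 0"
    using sums by (simp add: d sum_subtractf)
  have "1 \<le> card (vars G)" using ne fin_U by (simp add: Suc_leI card_gt_0_iff)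
  then have "1 * 1 \<le> K * card (vars G)" using K by (intro mult_mono) auto
  then have \<rho>: "0 \<le> ?\<rho>" by simp
  have "ip W d d \<le> (?\<rho> ^ t)\<^sup>2 * ip W d0 d0"
    unfolding d_def by (intro sampler_iterate pos_weight_gibbs ne K poincare mean0)
  also have "\<dots> \<le> (?\<rho> ^ t)\<^sup>2 * B"
    unfolding d0_def by (intro mult_left_mono initial_distance \<mu> B) auto
  finally have "sqrt (ip W d d) \<le> sqrt ((?\<rho> ^ t)\<^sup>2 * B)"
    by (rule real_sqrt_le_mono)
  also have "\<dots> = ?\<rho> ^ t * sqrt B"
    using \<rho> by (simp add: real_sqrt_mult)
  finally have dist: "sqrt (ip W d d) \<le> 1 / 2" using t by linarith
  have "\<bar>measure_pmf.prob ?\<nu> A - measure_pmf.prob (gibbs_distribution G) A\<bar> \<le> 1 / 4"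
    if A: "A \<subseteq> points" for A
  proof -
    have "finite A" using A finite_points finite_subset by blast
    then have "measure_pmf.prob ?\<nu> A - measure_pmf.prob (gibbs_distribution G) A =
        (\<Sum>x\<in>A. W x * d x)"
      using A d by (simp add: measure_measure_pmf_finite sum_subtractf[symmetric] subset_eq)
    then show ?thesis
      using total_variation_le[OF pos_weight_gibbs sums(1) mean A] dist by simp
  qed
  then show "tv_distance points ?\<nu> (gibbs_distribution G) \<le> 1 / 4"
    unfolding tv_distance_def using finite_points by (subst Max_le_iff) auto
qed

section \<open>Weight bounds, the Poincare constant and the smallest stationary probability\<close>

lemma potential_diff_le:
  assumes "f \<in> factors G" "x \<in> points" "y \<in> points"
  shows "potential G f x - potential G f y \<le> max_factor_weight G"
proof -
  let ?w = "\<lambda>f. (MAX I\<in>points. potential G f I) - (MIN I\<in>points. potential G f I)"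
  have "potential G f x \<le> (MAX I\<in>points. potential G f I)"
    "(MIN I\<in>points. potential G f I) \<le> potential G f y"
    using assms finite_points by (auto intro: Max_ge Min_le)
  then have "potential G f x - potential G f y \<le> ?w f" by linarith
  also have "?w f \<le> (MAX f\<in>factors G. ?w f)"
    using assms finite_factors by (intro Max_ge) auto
  finally show ?thesis
    using assms unfolding max_factor_weight_def worlds_eq by auto
qed

lemma max_factor_weight_nonneg: "0 \<le> max_factor_weight G"
proof (cases "factors G = {}")
  case False
  then obtain f x where "f \<in> factors G" "x \<in> points" using points_nonempty by blast
  then show ?thesis using potential_diff_le[of f x x] by simp
qed (simp add: max_factor_weight_def)

lemma indep_potential:
  assumes "\<not> depends_on G f v"
  shows "indep {v} (potential G f)"
  unfolding indep_def
proof (intro ballI)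
  fix x y assume "x \<in> points" "y \<in> fibre {v} x"
  then show "potential G f y = potential G f x"
    using assms unfolding depends_on_def worlds_eq fibre_def by blast
qed

text \<open>The recursion starts from all variables and factors, with the normalization as the
  initial \<open>u\<close>.\<close>

lemma gibbs_poincare:
  "dev W (vars G) g \<le>
    exp (real (hierarchy_width G) * max_factor_weight G) * (\<Sum>v\<in>vars G. dev W {v} g)"
  unfolding hierarchy_width_def
proof (rule dev_le_hierarchy[where u = "\<lambda>_. 1 / partition_constant G" and \<phi> = "potential G"])
  show "pos_weight (\<lambda>_. 1 / partition_constant G)"
    unfolding pos_weight_def using partition_constant_pos by simp
  show "W x = 1 / partition_constant G * exp (\<Sum>f\<in>factors G. potential G f x)" if "x \<in> points" for x
    using that by (simp add: pmf_gibbs_distribution energy_def)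
qed (auto simp: fin_U finite_factors max_factor_weight_nonneg indep_const
    intro: potential_diff_le indep_potential)

lemma states_bound_pos:
  assumes "\<forall>v\<in>vars G. card (states G v) \<le> s" "vars G \<noteq> {}"
  shows "1 \<le> s"
proof -
  obtain v where "v \<in> vars G" using assms(2) by blast
  then have "card (states G v) \<noteq> 0" "card (states G v) \<le> s"
    using fin_S nonempty_S assms(1) by auto
  then show ?thesis by linarith
qed

text \<open>\<open>1 / W x\<close> is the sum of \<open>exp (energy G y - energy G x)\<close> over
  all worlds \<open>y\<close>; there are at most \<open>s ^ card (vars G)\<close> of them, and each
  factor changes the energy by at most the maximum weight.\<close>

lemma gibbs_weight_ge:
  assumes "\<forall>v\<in>vars G. card (states G v) \<le> s" and x: "x \<in> points"
  shows "1 / W x \<le> exp (card (vars G) * ln (real s) + card (factors G) * max_factor_weight G)"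
proof -
  let ?e = "real (card (factors G)) * max_factor_weight G"
  have "energy G y - energy G x \<le> ?e" if "y \<in> points" for y
  proof -
    have "energy G y - energy G x = (\<Sum>f\<in>factors G. potential G f y - potential G f x)"
      unfolding energy_def by (simp add: sum_subtractf)
    also have "\<dots> \<le> ?e"
      using that x by (intro sum_bounded_above potential_diff_le)
    finally show ?thesis .
  qed
  note en = this
  have "1 / W x = (\<Sum>y\<in>points. exp (energy G y - energy G x))"
    using x by (simp add: pmf_gibbs_distribution partition_constant_def worlds_eq
        exp_diff sum_divide_distrib)
  also have "\<dots> \<le> (\<Sum>y\<in>points. exp ?e)"
    by (intro sum_mono) (simp add: en)
  also have "\<dots> = card points * exp ?e" by simp
  also have "card points = (\<Prod>v\<in>vars G. card (states G v))"
    unfolding points_def by (rule card_PiE[OF fin_U])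
  also have "\<dots> \<le> s ^ card (vars G)"
    using assms(1) states_bound_pos[OF assms(1)]
    by (cases "vars G = {}") (auto intro!: prod_le_power)
  finally have "1 / W x \<le> real (s ^ card (vars G)) * exp ?e"
    by (simp add: mult_right_mono)
  \<comment> \<open>Without variables \<open>s\<close> may be \<open>0\<close>, but both sides are
    then \<open>1\<close>.\<close>
  also have "real (s ^ card (vars G)) = exp (card (vars G) * ln (real s))"
  proof (cases "vars G = {}")
    case False
    then show ?thesis using states_bound_pos[OF assms(1)] by (simp add: exp_of_nat_mult)
  qed simp
  finally show ?thesis by (simp add: exp_add)
qed

section \<open>The mixing time bound for one factor graph\<close>

lemma mixed_at_bound:
  fixes s
  assumes s: "\<forall>v\<in>vars G. card (states G v) \<le> s"
  defines "n \<equiv> real (card (vars G))" and "e \<equiv> real (card (factors G))"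
    and "M \<equiv> max_factor_weight G" and "h \<equiv> real (hierarchy_width G)"
  shows "\<exists>t. mixed_at G t \<and> real t \<le> (ln 4 + n * ln (real s) + e * M) * n * exp (3 * h * M)"
proof (cases "vars G = {}")
  case True
  \<comment> \<open>Without variables the claimed bound is \<open>0\<close>; there is a single
    world, hence a single law, which is mixed at time \<open>0\<close>.\<close>
  have p: "points = {\<lambda>_. undefined}" unfolding points_def by (simp add: True)
  have "\<mu> = gibbs_distribution G" if "set_pmf \<mu> \<subseteq> points" for \<mu>
    using that set_gibbs_distribution p set_pmf_subset_singleton
    by (metis order_refl)
  then have "mixed_at G 0"
    unfolding mixed_at_def worlds_eq gibbs_law_def tv_distance_def p by (auto simp: Pow_insert)
  then show ?thesis unfolding n_def True by (intro exI[of _ 0]) simp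
next
  case False
  then obtain v where v: "v \<in> vars G" by blast
  have s1: "1 \<le> s" by (rule states_bound_pos[OF s False])
  define L where "L = n * ln (real s) + e * M"
  have M0: "0 \<le> M" unfolding M_def by (rule max_factor_weight_nonneg)
  have L0: "0 \<le> L" unfolding L_def n_def e_def using s1 M0 by simp
  have ln4: "ln 4 = 2 * ln (2::real)" using ln_realpow[of 2 2] by simp
  have ln2: "1 / 2 < ln (2::real)" using ln2_ge_two_thirds by simp
  have B: "1 / W x \<le> exp L" if "x \<in> points" for x
    using gibbs_weight_ge[OF s that] unfolding L_def n_def e_def M_def .
  have E0: "0 \<le> h * M" unfolding h_def using M0 by simp
  show ?thesis
  proof (cases "card (vars G) = 1")
    case True
    then have U: "vars G = {v}" using v by (auto simp: card_1_singleton_iff)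
    \<comment> \<open>For one variable the Poincare inequality holds with \<open>K = 1\<close>, so
      the decay factor is \<open>0\<close> and one step suffices; the claimed bound is at least
      \<open>1\<close> because \<open>ln 4\<close> exceeds \<open>1\<close>.\<close>
    have "mixed_at G 1"
      by (rule mixed_at_if[where K = 1, OF False _ _ B]) (simp_all add: U)
    moreover have "1 * 1 \<le> (ln 4 + L) * exp (3 * h * M)"
      using ln4 ln2 L0 E0 by (intro mult_mono) (auto simp: mult.assoc mult.commute[of M h])
    ultimately show ?thesis
      using True unfolding n_def L_def by (intro exI[of _ 1]) (simp add: add.assoc)
  next
    case n1: False
    have "card (vars G) \<noteq> 0" using False fin_U by simp
    then have n2: "2 \<le> n" using n1 unfolding n_def by simp
    define K where "K = exp (h * M)"
    have K1: "1 \<le> K" unfolding K_def using E0 by simp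
    have nK: "2 \<le> n * K" using mult_mono[of 2 n 1 K] n2 K1 by simp
    \<comment> \<open>\<open>T\<close> makes \<open>exp (- T / (n * K))\<close> equal to
      \<open>exp (- L / 2) / 2\<close>, which offsets the square root of the initial bound
      \<open>exp L\<close> and leaves the threshold \<open>1 / 2\<close>.\<close>
    define T where "T = n * K * (ln 2 + L / 2)"
    \<comment> \<open>\<open>n * K \<ge> 2\<close> and \<open>ln 2 > 1 / 2\<close> give
      \<open>T \<ge> 1\<close>, so that the rounding loss in \<open>T + 1\<close> is absorbed by
      \<open>2 * T\<close>.\<close>
    have "2 * (1 / 2) \<le> T"
      unfolding T_def using nK ln2 L0 by (intro mult_mono) auto
    then have T1: "1 \<le> T" by simp
    define t where "t = nat \<lceil>T\<rceil>"
    have t: "T \<le> real t" "real t \<le> T + 1"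
      unfolding t_def using T1 by linarith+
    have half: "sqrt (exp L) = exp (L / 2)"
      by (rule real_sqrt_unique) (simp_all add: exp_of_nat_mult[symmetric])
    have "1 - 1 / (K * n) \<le> exp (- (1 / (K * n)))"
      using exp_ge_add_one_self[of "- (1 / (K * n))"] by simp
    moreover have "0 \<le> 1 - 1 / (K * n)" using nK by (simp add: mult.commute)
    ultimately have "(1 - 1 / (K * n)) ^ t \<le> exp (- (1 / (K * n))) ^ t"
      by (intro power_mono)
    also have "\<dots> = exp (- (real t / (K * n)))"
      by (simp add: exp_of_nat_mult[symmetric])
    also have "\<dots> \<le> exp (- (ln 2 + L / 2))"
      using t(1) nK unfolding T_def by (simp add: field_simps)
    finally have "(1 - 1 / (K * n)) ^ t * exp (L / 2) \<le> exp (- (ln 2 + L / 2)) * exp (L / 2)"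
      by (rule mult_right_mono) simp
    also have "exp (- (ln 2 + L / 2)) * exp (L / 2) = 1 / 2"
      by (simp add: exp_add[symmetric] exp_minus inverse_eq_divide)
    finally have small: "(1 - 1 / (K * n)) ^ t * sqrt (exp L) \<le> 1 / 2"
      unfolding half .
    have "dev W (vars G) g \<le> K * (\<Sum>v\<in>vars G. dev W {v} g)" for g
      unfolding K_def h_def M_def by (rule gibbs_poincare)
    then have "mixed_at G t"
      using small unfolding n_def by (intro mixed_at_if[OF False K1 _ B])
    moreover have "real t \<le> (ln 4 + L) * n * exp (3 * h * M)"
    proof -
      \<comment> \<open>Doubling \<open>ln 2 + L / 2\<close> yields exactly \<open>ln 4 + L\<close>;
        then \<open>exp (h * M)\<close> is enlarged to \<open>exp (3 * h * M)\<close>.\<close>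
      have "real t \<le> 2 * T" using t(2) T1 by simp
      also have "\<dots> = (ln 4 + L) * n * K" unfolding T_def ln4 by (simp add: algebra_simps)
      also have "\<dots> \<le> (ln 4 + L) * n * exp (3 * h * M)"
        unfolding K_def using E0 L0 ln4 ln2 n2
        by (intro mult_left_mono mult_nonneg_nonneg) (auto simp: mult.assoc mult.commute[of M h])
      finally show ?thesis .
    qed
    ultimately show ?thesis unfolding L_def by (auto simp: add.assoc)
  qed
qed

text \<open>Any mixed time bounds the least one, and its existence gives the \<open>LEAST\<close> in
  \<open>mixing_time\<close> a meaning.\<close>

lemma mixing_time_bound:
  assumes "\<forall>v\<in>vars G. card (states G v) \<le> s"
  shows "\<exists>t. mixed_at G t"
    and "real (mixing_time G) \<le>
      (ln 4 + real (card (vars G)) * ln (real s) + real (card (factors G)) * max_factor_weight G)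
        * real (card (vars G)) * exp (3 * real (hierarchy_width G) * max_factor_weight G)"
proof -
  obtain t where t: "mixed_at G t" "real t \<le>
      (ln 4 + real (card (vars G)) * ln (real s) + real (card (factors G)) * max_factor_weight G)
        * real (card (vars G)) * exp (3 * real (hierarchy_width G) * max_factor_weight G)"
    using mixed_at_bound[OF assms] by blast
  have "mixing_time G \<le> t" unfolding mixing_time_def using t(1) by (rule Least_le)
  then show "real (mixing_time G) \<le>
      (ln 4 + real (card (vars G)) * ln (real s) + real (card (factors G)) * max_factor_weight G)
        * real (card (vars G)) * exp (3 * real (hierarchy_width G) * max_factor_weight G)"
    using t(2) by linarith
  show "\<exists>t. mixed_at G t" using t(1) by blast
qed

text \<open>Either there are no factors and the weight is \<open>0\<close>, or the hierarchy width
  is at least \<open>1\<close>. This turns control of the product into control of the weight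
  alone.\<close>

lemma max_factor_weight_le: "max_factor_weight G \<le> real (hierarchy_width G) * max_factor_weight G"
proof (cases "factors G = {}")
  case False
  then have "1 \<le> hierarchy_width G"
    unfolding hierarchy_width_def using hwidth_pos[OF fin_U finite_factors] by (simp add: Suc_leI)
  then have "1 * max_factor_weight G \<le> real (hierarchy_width G) * max_factor_weight G"
    using max_factor_weight_nonneg by (intro mult_right_mono) auto
  then show ?thesis by simp
qed (simp add: max_factor_weight_def)

end

section \<open>Polynomial mixing over a class of factor graphs\<close>

lemma mixing_time_polynomial:
  fixes \<G> :: "('v, 'a, 'f) factor_graph set"
  assumes fg: "\<forall>G\<in>\<G>. is_factor_graph G"
    and e: "(\<lambda>G. real (card (factors G))) \<in> O[growing_in \<G>](\<lambda>G. real (card (vars G)) ^ k)"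
    and s: "\<forall>G\<in>\<G>. \<forall>v\<in>vars G. card (states G v) \<le> s"
    and hM: "(\<lambda>G. real (hierarchy_width G) * max_factor_weight G)
        \<in> O[growing_in \<G>](\<lambda>G. ln (real (card (vars G))))"
  shows "\<exists>m. (\<lambda>G. real (mixing_time G)) \<in> O[growing_in \<G>](\<lambda>G. real (card (vars G)) ^ m)"
proof -
  obtain c where c: "c > 0" "\<forall>\<^sub>F G in growing_in \<G>.
      norm (real (card (factors G))) \<le> c * norm (real (card (vars G)) ^ k)"
    using e by (elim landau_o.bigE)
  obtain c' where c': "c' > 0" "\<forall>\<^sub>F G in growing_in \<G>.
      norm (real (hierarchy_width G) * max_factor_weight G) \<le> c' * norm (ln (real (card (vars G))))"
    using hM by (elim landau_o.bigE)
  define q where "q = nat \<lceil>3 * c'\<rceil>"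
  \<comment> \<open>The bracket contributes degree \<open>k + 1\<close>, the number of variables one
    more, and the exponential at most degree \<open>q\<close>.\<close>
  define m where "m = k + 2 + q"
  have mem: "\<forall>\<^sub>F G in growing_in \<G>. G \<in> \<G>"
    unfolding growing_in_def eventually_inf_principal by simp
  \<comment> \<open>From one variable on, the logarithm of their number is nonnegative and
    \<open>s\<close> is forced to be at least \<open>1\<close>.\<close>
  have large: "\<forall>\<^sub>F G in growing_in \<G>. 1 \<le> card (vars G)"
    unfolding growing_in_def eventually_inf_principal
    by (rule eventually_mono[OF eventually_filtercomapI[OF eventually_ge_at_top[of 1]]]) simp
  have "\<forall>\<^sub>F G in growing_in \<G>.
      norm (real (mixing_time G)) \<le> (ln 4 + real s + c * c') * norm (real (card (vars G)) ^ m)"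
    using c(2) c'(2) mem large
  proof eventually_elim
    case (elim G)
    interpret gibbs_chain G using fg elim(3) by unfold_locales blast
    let ?n = "real (card (vars G))" and ?M = "max_factor_weight G"
      and ?h = "real (hierarchy_width G)"
    have n1: "1 \<le> ?n" using elim(4) by simp
    have M0: "0 \<le> ?M" by (rule max_factor_weight_nonneg)
    have sG: "\<forall>v\<in>vars G. card (states G v) \<le> s" using s elim(3) by blast
    have lnn: "0 \<le> ln ?n" "ln ?n \<le> ?n" using n1 ln_le_minus_one[of ?n] by auto
    have hM: "?h * ?M \<le> c' * ln ?n" using elim(2) lnn(1) by simp
    have "vars G \<noteq> {}" using elim(4) by auto
    then have "1 \<le> s" by (rule states_bound_pos[OF sG])
    then have lns: "0 \<le> ln (real s)" "ln (real s) \<le> real s"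
      using ln_le_minus_one[of "real s"] by auto
    \<comment> \<open>The hypotheses control the weight only through its product with the hierarchy
      width; together with \<open>ln ?n \<le> ?n\<close> this makes it at most linear.\<close>
    have "?M \<le> c' * ?n"
      using max_factor_weight_le hM mult_left_mono[OF lnn(2), of c'] c'(1) by linarith
    then have "real (card (factors G)) * ?M \<le> (c * ?n ^ k) * (c' * ?n)"
      using elim(1) M0 n1 c(1) by (intro mult_mono) auto
    also have "\<dots> = c * c' * ?n ^ (k + 1)" by simp
    finally have eM: "real (card (factors G)) * ?M \<le> c * c' * ?n ^ (k + 1)" .
    have pow: "1 \<le> ?n ^ (k + 1)" "?n ^ 1 \<le> ?n ^ (k + 1)"
      using n1 by (rule one_le_power, intro power_increasing) simp_all
    have "ln 4 * 1 \<le> ln 4 * ?n ^ (k + 1)"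
      by (rule mult_left_mono[OF pow(1)]) simp
    moreover have "?n * ln (real s) \<le> ?n ^ (k + 1) * real s"
      using pow(2) lns by (intro mult_mono) simp_all
    ultimately have sum: "ln 4 + ?n * ln (real s) + real (card (factors G)) * ?M
        \<le> (ln 4 + real s + c * c') * ?n ^ (k + 1)"
      using eM by (simp only: distrib_right mult.commute[of "real s"])
    have "3 * ?h * ?M \<le> real q * ln ?n"
    proof -
      have "3 * ?h * ?M \<le> 3 * c' * ln ?n" using hM by simp
      also have "3 * c' \<le> real q" unfolding q_def using c'(1) by linarith
      finally show ?thesis using lnn(1) by (simp add: mult_right_mono)
    qed
    then have "exp (3 * ?h * ?M) \<le> exp (real q * ln ?n)" by simp
    also have "\<dots> = ?n ^ q" using n1 by (simp add: exp_of_nat_mult)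
    finally have ex: "exp (3 * ?h * ?M) \<le> ?n ^ q" .
    have "0 \<le> (ln 4 + real s + c * c') * ?n ^ (k + 1)"
      using c(1) c'(1) by (intro mult_nonneg_nonneg add_nonneg_nonneg) auto
    then have "real (mixing_time G) \<le> ((ln 4 + real s + c * c') * ?n ^ (k + 1)) * ?n * ?n ^ q"
      by (intro order_trans[OF mixing_time_bound(2)[OF sG]] mult_mono sum ex order_refl) auto
    also have "\<dots> = (ln 4 + real s + c * c') * ?n ^ m"
      unfolding m_def by (simp add: power_add power2_eq_square)
    finally show ?case by simp
  qed
  then show ?thesis by (blast intro: bigoI)
qed

theorem theorem2:
  "(\<forall>(G :: ('v, 'a, 'f) factor_graph) n s e M h.
      is_factor_graph G \<and> card (vars G) = n \<and> (\<forall>v\<in>vars G. card (states G v) \<le> s) \<and>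
      card (factors G) = e \<and> max_factor_weight G = M \<and> hierarchy_width G = h
      \<longrightarrow> (\<exists>t. mixed_at G t) \<and>
          real (mixing_time G) \<le>
            (ln 4 + real n * ln (real s) + real e * M) * real n * exp (3 * real h * M)) \<and>
   (\<forall>(\<G> :: ('v, 'a, 'f) factor_graph set) s k.
      (\<forall>G\<in>\<G>. is_factor_graph G) \<and>
      (\<lambda>G. real (card (factors G))) \<in> O[growing_in \<G>](\<lambda>G. real (card (vars G)) ^ k) \<and>
      (\<forall>G\<in>\<G>. \<forall>v\<in>vars G. card (states G v) \<le> s) \<and>
      (\<lambda>G. real (hierarchy_width G) * max_factor_weight G)
        \<in> O[growing_in \<G>](\<lambda>G. ln (real (card (vars G))))
      \<longrightarrow> (\<exists>m. (\<lambda>G. real (mixing_time G))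
                  \<in> O[growing_in \<G>](\<lambda>G. real (card (vars G)) ^ m)))"
proof (intro conjI allI impI; elim conjE)
  fix G :: "('v, 'a, 'f) factor_graph" and n s e M h
  assume "is_factor_graph G" and s: "\<forall>v\<in>vars G. card (states G v) \<le> s"
    and eqs: "card (vars G) = n" "card (factors G) = e" "max_factor_weight G = M"
      "hierarchy_width G = h"
  then interpret gibbs_chain G by unfold_locales
  show "\<exists>t. mixed_at G t" by (rule mixing_time_bound(1)[OF s])
  show "real (mixing_time G) \<le>
      (ln 4 + real n * ln (real s) + real e * M) * real n * exp (3 * real h * M)"
    using mixing_time_bound(2)[OF s] unfolding eqs .
qed (rule mixing_time_polynomial)

end
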